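(* Suppose the body force $\mathbf{g}$ is conservative, i.e. $\mathbf{g}=-\nabla\varphi$ for some scalar field $\varphi$ in $\Omega$, and let $(\mathbf{w},\mathbf{u},q)$ be a sufficiently smooth solution of the GePUP-E formulation (described in the context). Then the kinetic energy $E_{\mathrm{kinetic}}(t)=\frac12\|\mathbf{u}(t)\|^2=\frac12\int_\Omega\mathbf{u}\cdot\mathbf{u}\,\mathrm{d}V$ evolves according to $$\frac{\mathrm{d}}{\mathrm{d}t}E_{\mathrm{kinetic}}=-\nu\|\nabla\mathbf{u}\|^2:=-\nu\sum_{i=1}^{D}\sum_{j=1}^{D}\int_\Omega\left|\frac{\partial u_i}{\partial x_j}\right|^2\mathrm{d}V.$$
   Context: $\Omega\subset\mathbb{R}^D$ is a bounded connected open set with sufficiently smooth boundary, unit outward normal $\mathbf{n}$ and unit tangent vector(s) $\boldsymbol{\tau}$ on $\partial\Omega$. $\nu>0$ is the kinematic viscosity, $\lambda\ge 0$ a penalty parameter. The Leray–Helmholtz projection $\mathscr{P}$ maps a $C^1$ vector field $\mathbf{v}^*$ to $\mathbf{v}^*-\nabla\phi$ where $\Delta\phi=\nabla\cdot\mathbf{v}^*$ in $\Omega$ and $\mathbf{n}\cdot\nabla\phi=\mathbf{n}\cdot\mathbf{v}^*$ on $\partial\Omega$. The GePUP-E formulation is the system for $(\mathbf{w},\mathbf{u},q)$: $\partial_t\mathbf{w}=\mathbf{g}-\mathbf{u}\cdot\nabla\mathbf{u}-\nabla q+\nu\Delta\mathbf{w}$ in $\Omega$; $\mathbf{w}\cdot\boldsymbol{\tau}=0$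 and $\nabla\cdot\mathbf{w}=0$ on $\partial\Omega$; $\mathbf{u}=\mathscr{P}\mathbf{w}$ in $\Omega$, $\mathbf{u}\cdot\mathbf{n}=0$ on $\partial\Omega$; $\Delta q=\nabla\cdot(\mathbf{g}-\mathbf{u}\cdot\nabla\mathbf{u})$ in $\Omega$; $\mathbf{n}\cdot\nabla q=\mathbf{n}\cdot(\mathbf{g}-\mathbf{u}\cdot\nabla\mathbf{u}+\nu\Delta\mathbf{w})+\lambda\,\mathbf{n}\cdot\mathbf{w}$ on $\partial\Omega$; with initial condition $\mathbf{w}(\mathbf{x},t_0)=\mathbf{u}(\mathbf{x},t_0)$ for all $\mathbf{x}\in\overline{\Omega}$. *)

theory Defs
  imports "HOL-Analysis.Analysis"
begin

fun Ck_on :: "nat \<Rightarrow> 'a::euclidean_space set \<Rightarrow> ('a \<Rightarrow> 'b::real_normed_vector) \<Rightarrow> bool" where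
  "Ck_on 0 U f = continuous_on U f"
| "Ck_on (Suc k) U f =
     (f differentiable_on U \<and> (\<forall>b\<in>Basis. Ck_on k U (\<lambda>x. frechet_derivative f (at x) b)))"

definition smooth_on :: "'a::euclidean_space set \<Rightarrow> ('a \<Rightarrow> 'b::real_normed_vector) \<Rightarrow> bool" where
  "smooth_on U f \<longleftrightarrow> (\<forall>k. Ck_on k U f)"

definition pd :: "'n::finite \<Rightarrow> (real^'n \<Rightarrow> real) \<Rightarrow> real^'n \<Rightarrow> real" where
  "pd j f x = frechet_derivative f (at x) (axis j 1)"

definition grad :: "(real^'n::finite \<Rightarrow> real) \<Rightarrow> real^'n \<Rightarrow> real^'n" where
  "grad f x = (\<chi> j. pd j f x)"

definition divg :: "(real^'n::finite \<Rightarrow> real^'n) \<Rightarrow> real^'n \<Rightarrow> real" where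
  "divg v x = (\<Sum>i\<in>UNIV. pd i (\<lambda>y. v y $ i) x)"

definition lap :: "(real^'n::finite \<Rightarrow> real) \<Rightarrow> real^'n \<Rightarrow> real" where
  "lap f x = (\<Sum>j\<in>UNIV. pd j (pd j f) x)"

definition vlap :: "(real^'n::finite \<Rightarrow> real^'n) \<Rightarrow> real^'n \<Rightarrow> real^'n" where
  "vlap v x = (\<chi> i. lap (\<lambda>y. v y $ i) x)"

definition conv :: "(real^'n::finite \<Rightarrow> real^'n) \<Rightarrow> (real^'n \<Rightarrow> real^'n) \<Rightarrow> real^'n \<Rightarrow> real^'n" where
  "conv u v x = (\<chi> i. \<Sum>j\<in>UNIV. u x $ j * pd j (\<lambda>y. v y $ i) x)"

definition defining_fun :: "(real^'n::finite) set \<Rightarrow> (real^'n \<Rightarrow> real) \<Rightarrow> bool" where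
  "defining_fun \<Omega> \<rho> \<longleftrightarrow> smooth_on UNIV \<rho> \<and> \<Omega> = {x. \<rho> x < 0} \<and>
     (\<forall>x. \<rho> x = 0 \<longrightarrow> grad \<rho> x \<noteq> 0)"

definition smooth_domain :: "(real^'n::finite) set \<Rightarrow> bool" where
  "smooth_domain \<Omega> \<longleftrightarrow> open \<Omega> \<and> bounded \<Omega> \<and> connected \<Omega> \<and> \<Omega> \<noteq> {} \<and>
     (\<exists>\<rho>. defining_fun \<Omega> \<rho>)"

definition normal :: "(real^'n::finite \<Rightarrow> real) \<Rightarrow> real^'n \<Rightarrow> real^'n" where
  "normal \<rho> x = (1 / norm (grad \<rho> x)) *\<^sub>R grad \<rho> x"

definition leray :: "(real^'n::finite) set \<Rightarrow> (real^'n \<Rightarrow> real) \<Rightarrow> (real^'n \<Rightarrow> real^'n)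
     \<Rightarrow> (real^'n \<Rightarrow> real^'n) \<Rightarrow> bool" where
  "leray \<Omega> \<rho> v u \<longleftrightarrow> (\<exists>\<phi> V. open V \<and> closure \<Omega> \<subseteq> V \<and> Ck_on 2 V \<phi> \<and>
     (\<forall>x\<in>\<Omega>. lap \<phi> x = divg v x) \<and>
     (\<forall>x\<in>frontier \<Omega>. normal \<rho> x \<bullet> grad \<phi> x = normal \<rho> x \<bullet> v x) \<and>
     (\<forall>x\<in>closure \<Omega>. u x = v x - grad \<phi> x))"

definition GePUP_E ::
  "(real^'n::finite) set \<Rightarrow> (real^'n \<Rightarrow> real) \<Rightarrow> real \<Rightarrow> real \<Rightarrow> real \<Rightarrow> real \<Rightarrow>
   (real \<Rightarrow> real^'n \<Rightarrow> real^'n) \<Rightarrow>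
   (real \<Rightarrow> real^'n \<Rightarrow> real^'n) \<Rightarrow> (real \<Rightarrow> real^'n \<Rightarrow> real^'n) \<Rightarrow> (real \<Rightarrow> real^'n \<Rightarrow> real) \<Rightarrow> bool"
  where
  "GePUP_E \<Omega> \<rho> \<nu> lam t0 T g w u q \<longleftrightarrow>
     (\<forall>t\<in>{t0<..<T}. \<forall>x\<in>\<Omega>.
        ((\<lambda>s. w s x) has_vector_derivative
           (g t x - conv (u t) (u t) x - grad (q t) x + \<nu> *\<^sub>R vlap (w t) x)) (at t)) \<and>
     (\<forall>t\<in>{t0<..<T}. \<forall>x\<in>frontier \<Omega>.
        (\<forall>\<tau>. \<tau> \<bullet> normal \<rho> x = 0 \<longrightarrow> w t x \<bullet> \<tau> = 0) \<and> divg (w t) x = 0) \<and>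
     (\<forall>t\<in>{t0<..<T}. leray \<Omega> \<rho> (w t) (u t)) \<and>
     (\<forall>t\<in>{t0<..<T}. \<forall>x\<in>frontier \<Omega>. u t x \<bullet> normal \<rho> x = 0) \<and>
     (\<forall>t\<in>{t0<..<T}. \<forall>x\<in>\<Omega>.
        lap (q t) x = divg (\<lambda>y. g t y - conv (u t) (u t) y) x) \<and>
     (\<forall>t\<in>{t0<..<T}. \<forall>x\<in>frontier \<Omega>.
        normal \<rho> x \<bullet> grad (q t) x =
          normal \<rho> x \<bullet> (g t x - conv (u t) (u t) x + \<nu> *\<^sub>R vlap (w t) x)
          + lam * (normal \<rho> x \<bullet> w t x)) \<and>
     (\<forall>x\<in>closure \<Omega>. w t0 x = u t0 x)"

end

theory Submission
  imports Defs
begin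

text \<open>Along a solution, \<open>\<nabla>\<cdot>w\<close> satisfies the heat equation with zero initial and boundary values,
  so it vanishes by the weak maximum principle; on the boundary \<open>n\<cdot>w\<close> satisfies \<open>y' = -lam y\<close> with
  \<open>y(t0) = 0\<close>, so it vanishes too, and with it all of \<open>w\<close>.  Hence the Leray potential of \<open>w\<close> is harmonic
  with zero Neumann data, its gradient vanishes, and \<open>u = w\<close> is divergence free and zero on the boundary.
  The pressure, the potential and the convective term then integrate to zero against \<open>u\<close>, and the viscous
  term gives the dissipation.

  The divergence theorem is needed only for fields \<open>F\<close> tangential to the boundary.  Multiplying \<open>F\<close> by
  \<open>\<rho>\<^sup>2 / (\<epsilon> + \<rho>\<^sup>2)\<close> makes it extend by zero to a field with bounded partial derivatives, for which
  translation invariance of the integral suffices.  The error term contains \<open>\<nabla>\<rho> \<bullet> F\<close>, which is bounded by a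
  multiple of \<open>\<bar>\<rho>\<bar>\<close>, so dominated convergence applies as \<open>\<epsilon> \<rightarrow> 0\<close>.\<close>

section \<open>Directional derivatives\<close>

text \<open>Every integration by parts is arranged so that no boundary term arises: the field is
  either tangential (the gradient of the Leray potential) or carries a factor that vanishes on the
  boundary (everything else, once \<open>w\<close> vanishes there). So no surface measure is ever
  needed. The weight vanishes to second order at the boundary; therefore its product with a bounded
  function extends by zero differentiably along every line, even one touching the boundary. A weight
  of first order would leave a kink. The pressure is designed for the two cancellations: its Poisson
  equation removes force and convection from the divergence of the momentum equation, leaving the
  heat equation, and its Neumann condition removes all but the penalty from the normal component.
  The latter needs the momentum equation on the boundary, where it is not imposed, so it is extended
  there by continuity. Likewise only \<open>w\<close> = \<open>u\<close> is imposed at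
  \<open>t0\<close>; the other initial values are limits from later times. The Leray potential is
  given for each time separately, with no regularity in time. It is used at fixed times only, and
  time derivatives are taken of \<open>w\<close> alone.\<close>

text \<open>Stated for any normed space, because it serves both as the spatial partial derivative
  \<open>pd\<close> and as a derivative on space-time.\<close>

definition dd :: "'a::real_normed_vector \<Rightarrow> ('a \<Rightarrow> 'b::real_normed_vector) \<Rightarrow> 'a \<Rightarrow> 'b" where
  "dd b f x = frechet_derivative f (at x) b"

lemma pd_eq_dd: "pd j f = dd (axis j 1) f"
  by (simp add: pd_def dd_def fun_eq_iff)

lemma dd_eq: "(f has_derivative D) (at x) \<Longrightarrow> dd b f x = D b"
  unfolding dd_def using frechet_derivative_at by fastforce

lemma dd_cong:
  assumes "open S" "x \<in> S" "\<And>y. y \<in> S \<Longrightarrow> f y = g y" "f differentiable (at x)"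
  shows "dd b g x = dd b f x"
  unfolding dd_def using frechet_derivative_transform_within_open[OF assms(4,1,2,3)] by simp

lemma dd_line:
  fixes f :: "'a::real_normed_vector \<Rightarrow> real"
  assumes "f differentiable (at (x + s *\<^sub>R b))"
  shows "((\<lambda>s. f (x + s *\<^sub>R b)) has_real_derivative dd b f (x + s *\<^sub>R b)) (at s)"
proof -
  have d: "(f has_derivative frechet_derivative f (at (x + s *\<^sub>R b))) (at (x + s *\<^sub>R b))"
    using assms frechet_derivative_works by blast
  have "((\<lambda>s. x + s *\<^sub>R b) has_derivative (\<lambda>h. h *\<^sub>R b)) (at s)"
    by (auto intro!: derivative_eq_intros)
  from diff_chain_at[OF this d]
  have "((\<lambda>s. f (x + s *\<^sub>R b)) has_derivative (\<lambda>h. frechet_derivative f (at (x + s *\<^sub>R b)) (h *\<^sub>R b))) (at s)"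
    by (simp add: o_def)
  moreover have "(\<lambda>h. frechet_derivative f (at (x + s *\<^sub>R b)) (h *\<^sub>R b)) = (*) (dd b f (x + s *\<^sub>R b))"
    using linear_frechet_derivative[OF assms] by (auto simp: dd_def linear_cmul fun_eq_iff)
  ultimately show ?thesis
    by (simp add: has_field_derivative_def)
qed

lemma differentiable_on_openD:
  "f differentiable_on S \<Longrightarrow> open S \<Longrightarrow> x \<in> S \<Longrightarrow> f differentiable (at x)"
  by (simp add: differentiable_on_eq_differentiable_at)

section \<open>Symmetry of second derivatives\<close>

text \<open>Two applications of the mean value theorem: one along \<open>a\<close>, to the increment
  of \<open>f\<close> in direction \<open>b\<close>, and one along \<open>b\<close>, to
  \<open>dd a f\<close>.\<close>

lemma second_difference_mean_value:
  fixes f :: "'a::real_normed_vector \<Rightarrow> real"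
  assumes S: "open S" and f: "f differentiable_on S" and fa: "dd a f differentiable_on S"
    and h: "h > 0" and box: "\<And>s r. 0 \<le> s \<Longrightarrow> s \<le> h \<Longrightarrow> 0 \<le> r \<Longrightarrow> r \<le> h \<Longrightarrow> x + s *\<^sub>R a + r *\<^sub>R b \<in> S"
  obtains \<xi> \<eta> where "0 < \<xi>" "\<xi> < h" "0 < \<eta>" "\<eta> < h"
    "f (x + h *\<^sub>R a + h *\<^sub>R b) - f (x + h *\<^sub>R a) - f (x + h *\<^sub>R b) + f x
      = h\<^sup>2 * dd b (dd a f) (x + \<xi> *\<^sub>R a + \<eta> *\<^sub>R b)"
proof -
  let ?\<phi> = "\<lambda>s. f ((x + h *\<^sub>R b) + s *\<^sub>R a) - f (x + s *\<^sub>R a)"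
  have "\<exists>z>0. z < h \<and> ?\<phi> h - ?\<phi> 0
      = (h - 0) * (dd a f ((x + h *\<^sub>R b) + z *\<^sub>R a) - dd a f (x + z *\<^sub>R a))"
  proof (rule MVT2[OF h])
    fix s assume s: "0 \<le> s" "s \<le> h"
    have "x + h *\<^sub>R b + s *\<^sub>R a \<in> S" "x + s *\<^sub>R a \<in> S"
      using box[of s h] box[of s 0] s h by (auto simp: add_ac)
    then show "(?\<phi> has_real_derivative
        (dd a f ((x + h *\<^sub>R b) + s *\<^sub>R a) - dd a f (x + s *\<^sub>R a))) (at s)"
      by (intro DERIV_diff dd_line differentiable_on_openD[OF f S])
  qed
  then obtain \<xi> where \<xi>: "0 < \<xi>" "\<xi> < h"
    "?\<phi> h - ?\<phi> 0 = h * (dd a f ((x + h *\<^sub>R b) + \<xi> *\<^sub>R a) - dd a f (x + \<xi> *\<^sub>R a))" by auto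
  let ?\<chi> = "\<lambda>r. dd a f ((x + \<xi> *\<^sub>R a) + r *\<^sub>R b)"
  have "\<exists>z>0. z < h \<and> ?\<chi> h - ?\<chi> 0 = (h - 0) * dd b (dd a f) ((x + \<xi> *\<^sub>R a) + z *\<^sub>R b)"
  proof (rule MVT2[OF h])
    fix r assume r: "0 \<le> r" "r \<le> h"
    have "x + \<xi> *\<^sub>R a + r *\<^sub>R b \<in> S"
      using box[of \<xi> r] r \<xi> by auto
    then show "(?\<chi> has_real_derivative dd b (dd a f) ((x + \<xi> *\<^sub>R a) + r *\<^sub>R b)) (at r)"
      by (intro dd_line differentiable_on_openD[OF fa S])
  qed
  then obtain \<eta> where \<eta>: "0 < \<eta>" "\<eta> < h" "?\<chi> h - ?\<chi> 0 = h * dd b (dd a f) ((x + \<xi> *\<^sub>R a) + \<eta> *\<^sub>R b)"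
    by auto
  have "?\<phi> h - ?\<phi> 0 = h * (?\<chi> h - ?\<chi> 0)"
    using \<xi>(3) by (simp add: add_ac)
  also have "\<dots> = h\<^sup>2 * dd b (dd a f) ((x + \<xi> *\<^sub>R a) + \<eta> *\<^sub>R b)"
    unfolding \<eta>(3) by (simp add: power2_eq_square)
  finally show ?thesis
    using that[OF \<xi>(1,2) \<eta>(1,2)] by (simp add: algebra_simps)
qed

text \<open>The second difference over a small parallelogram does not change when \<open>a\<close>
  and \<open>b\<close> are swapped, so it equals \<open>h\<^sup>2\<close> times either mixed
  derivative at some nearby point. Continuity then forbids a gap between the two at
  \<open>x\<close>.\<close>

lemma dd_commute:
  fixes f :: "'a::real_normed_vector \<Rightarrow> real"
  assumes S: "open S" "x \<in> S" and f: "f differentiable_on S"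
    and fa: "dd a f differentiable_on S" and fb: "dd b f differentiable_on S"
    and cab: "continuous_on S (dd b (dd a f))" and cba: "continuous_on S (dd a (dd b f))"
  shows "dd b (dd a f) x = dd a (dd b f) x"
proof (rule ccontr)
  let ?A = "dd b (dd a f)" and ?B = "dd a (dd b f)"
  assume "?A x \<noteq> ?B x"
  define e where "e = \<bar>?A x - ?B x\<bar> / 2"
  have e: "e > 0" using \<open>?A x \<noteq> ?B x\<close> by (simp add: e_def)
  have "isCont ?A x" "isCont ?B x"
    using cab cba S by (simp_all add: continuous_on_eq_continuous_at)
  then obtain r1 r2 where r: "r1 > 0" "\<And>y. dist y x < r1 \<Longrightarrow> \<bar>?A y - ?A x\<bar> < e"
      "r2 > 0" "\<And>y. dist y x < r2 \<Longrightarrow> \<bar>?B y - ?B x\<bar> < e"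
    using e unfolding continuous_at_eps_delta dist_real_def by metis
  obtain r3 where r3: "r3 > 0" "ball x r3 \<subseteq> S" using S open_contains_ball by blast
  define r0 where "r0 = min r1 (min r2 r3)"
  have r0: "r0 > 0" using r r3 by (simp add: r0_def)
  \<comment> \<open>Keeps the whole parallelogram with sides \<open>h a\<close> and
    \<open>h b\<close> inside the ball of radius \<open>r0\<close>; the summand 1 covers the case
    that \<open>a\<close> and \<open>b\<close> are both 0.\<close>
  define h where "h = r0 / (2 * (norm a + norm b + 1))"
  have h: "h > 0" using r0 by (simp add: h_def add_nonneg_pos)
  have near: "dist (x + s *\<^sub>R a + t *\<^sub>R b) x < r0" if "0 \<le> s" "s \<le> h" "0 \<le> t" "t \<le> h" for s t
  proof -
    have "dist (x + s *\<^sub>R a + t *\<^sub>R b) x \<le> s * norm a + t * norm b"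
      using that norm_triangle_ineq[of "s *\<^sub>R a" "t *\<^sub>R b"] by (simp add: dist_norm add.assoc)
    also have "\<dots> \<le> h * norm a + h * norm b"
      using that by (intro add_mono mult_right_mono) auto
    also have "\<dots> < h * (2 * (norm a + norm b + 1))"
      using mult_pos_pos[OF h, of "norm a + norm b + 2"] by (simp add: algebra_simps add_nonneg_pos)
    also have "\<dots> = r0"
      using add_nonneg_pos[of "norm a + norm b" 1] by (simp add: h_def del: add_nonneg_pos)
    finally show ?thesis .
  qed
  have inS: "x + s *\<^sub>R a + t *\<^sub>R b \<in> S" "x + t *\<^sub>R b + s *\<^sub>R a \<in> S"
    if "0 \<le> s" "s \<le> h" "0 \<le> t" "t \<le> h" for s t
    using near[OF that] r3 by (auto simp: r0_def dist_commute add_ac subset_iff)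
  obtain s t where st: "0 < s" "s < h" "0 < t" "t < h"
    "f (x + h *\<^sub>R a + h *\<^sub>R b) - f (x + h *\<^sub>R a) - f (x + h *\<^sub>R b) + f x = h\<^sup>2 * ?A (x + s *\<^sub>R a + t *\<^sub>R b)"
    by (rule second_difference_mean_value[OF S(1) f fa h, of x b]) (use inS in auto)
  obtain s' t' where st': "0 < s'" "s' < h" "0 < t'" "t' < h"
    "f (x + h *\<^sub>R b + h *\<^sub>R a) - f (x + h *\<^sub>R b) - f (x + h *\<^sub>R a) + f x = h\<^sup>2 * ?B (x + s' *\<^sub>R b + t' *\<^sub>R a)"
    by (rule second_difference_mean_value[OF S(1) f fb h, of x a]) (use inS in auto)
  have "h\<^sup>2 * ?A (x + s *\<^sub>R a + t *\<^sub>R b) = h\<^sup>2 * ?B (x + s' *\<^sub>R b + t' *\<^sub>R a)"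
  proof -
    have "f (x + h *\<^sub>R b + h *\<^sub>R a) = f (x + h *\<^sub>R a + h *\<^sub>R b)" by (simp add: add_ac)
    then show ?thesis using st(5) st'(5) by linarith
  qed
  then have "?A (x + s *\<^sub>R a + t *\<^sub>R b) = ?B (x + s' *\<^sub>R b + t' *\<^sub>R a)"
    using h by simp
  moreover have "\<bar>?A (x + s *\<^sub>R a + t *\<^sub>R b) - ?A x\<bar> < e"
    using near[of s t] st r by (auto simp: r0_def)
  moreover have "\<bar>?B (x + s' *\<^sub>R b + t' *\<^sub>R a) - ?B x\<bar> < e"
    using near[of t' s'] st' r by (auto simp: r0_def add_ac)
  ultimately show False unfolding e_def by (simp add: abs_if field_simps split: if_splits)
qed

section \<open>Functions of class C1 and smooth functions\<close>

lemma Basis_axis: "(Basis :: (real^'n) set) = range (\<lambda>j. axis j 1)"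
  by (auto simp: Basis_vec_def)

text \<open>The first level of \<open>Ck_on\<close> for scalar functions, spelled out with
  \<open>pd\<close> so that sums and products can be handled by the pointwise rules for
  \<open>pd\<close>.\<close>

definition C1 :: "(real^'n::finite) set \<Rightarrow> (real^'n \<Rightarrow> real) \<Rightarrow> bool" where
  "C1 V f \<longleftrightarrow> f differentiable_on V \<and> (\<forall>j. continuous_on V (pd j f))"

lemma C1_continuous: "C1 V f \<Longrightarrow> continuous_on V f"
  by (simp add: C1_def differentiable_imp_continuous_on)

lemma C1_subset: "C1 V f \<Longrightarrow> W \<subseteq> V \<Longrightarrow> C1 W f"
  by (auto simp: C1_def intro: continuous_on_subset differentiable_on_subset)

lemma frechet_derivative_grad:
  fixes f :: "real^'n \<Rightarrow> real"
  assumes "f differentiable (at x)"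
  shows "frechet_derivative f (at x) h = grad f x \<bullet> h"
proof -
  have "h = (\<Sum>i\<in>UNIV. (h $ i) *\<^sub>R axis i 1)"
    using basis_expansion[of h] by (simp add: scalar_mult_eq_scaleR)
  then have "frechet_derivative f (at x) h = frechet_derivative f (at x) (\<Sum>i\<in>UNIV. (h $ i) *\<^sub>R axis i 1)" by simp
  also have "\<dots> = grad f x \<bullet> h"
    using linear_frechet_derivative[OF assms]
    by (simp add: linear_sum linear_cmul inner_vec_def grad_def pd_def mult.commute)
  finally show ?thesis .
qed

lemma pd_mult:
  assumes "f differentiable (at x)" "g differentiable (at x)"
  shows "pd j (\<lambda>x. f x * g x) x = f x * pd j g x + pd j f x * g x"
proof -
  have "((\<lambda>x. f x * g x) has_derivative
     (\<lambda>h. f x * frechet_derivative g (at x) h + frechet_derivative f (at x) h * g x)) (at x)"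
    using assms by (intro has_derivative_mult) (simp_all add: frechet_derivative_works)
  from dd_eq[OF this] show ?thesis by (simp add: pd_eq_dd) (simp add: dd_def)
qed

lemma pd_sum:
  assumes "finite A" "\<And>i. i \<in> A \<Longrightarrow> f i differentiable (at x)"
  shows "pd j (\<lambda>x. \<Sum>i\<in>A. f i x) x = (\<Sum>i\<in>A. pd j (f i) x)"
proof -
  have "((\<lambda>x. \<Sum>i\<in>A. f i x) has_derivative
     (\<lambda>h. \<Sum>i\<in>A. frechet_derivative (f i) (at x) h)) (at x)"
    using assms by (intro has_derivative_sum) (simp_all add: frechet_derivative_works)
  from dd_eq[OF this] show ?thesis by (simp add: pd_eq_dd) (simp add: dd_def)
qed

lemma C1_mult:
  fixes f g :: "real^'n \<Rightarrow> real"
  assumes V: "open V" and f: "C1 V f" and g: "C1 V g"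
  shows "C1 V (\<lambda>x. f x * g x)"
  unfolding C1_def
proof (intro conjI allI)
  show "(\<lambda>x. f x * g x) differentiable_on V"
    using f g by (intro derivative_intros) (auto simp: C1_def)
  fix j
  have "continuous_on V (\<lambda>x. f x * pd j g x + pd j f x * g x)"
    using f g by (intro continuous_intros) (auto simp: C1_def intro: differentiable_imp_continuous_on)
  then show "continuous_on V (pd j (\<lambda>x. f x * g x))"
    using f g V by (subst continuous_on_cong[OF refl pd_mult]) (auto simp: C1_def differentiable_on_openD)
qed

lemma C1_sum:
  fixes f :: "'i \<Rightarrow> real^'n \<Rightarrow> real"
  assumes V: "open V" and "finite A" and f: "\<And>i. i \<in> A \<Longrightarrow> C1 V (f i)"
  shows "C1 V (\<lambda>x. \<Sum>i\<in>A. f i x)"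
  unfolding C1_def
proof (intro conjI allI)
  show "(\<lambda>x. \<Sum>i\<in>A. f i x) differentiable_on V"
    using assms by (auto simp: C1_def differentiable_on_def intro!: differentiable_sum)
  fix j
  have "continuous_on V (\<lambda>x. \<Sum>i\<in>A. pd j (f i) x)"
    using f by (intro continuous_intros) (auto simp: C1_def)
  then show "continuous_on V (pd j (\<lambda>x. \<Sum>i\<in>A. f i x))"
    using assms by (subst continuous_on_cong[OF refl pd_sum]) (auto simp: C1_def intro: differentiable_on_openD)
qed

lemma Ck_on_Suc:
  "Ck_on (Suc k) U f \<longleftrightarrow> f differentiable_on U \<and> (\<forall>b\<in>Basis. Ck_on k U (dd b f))"
  by (simp add: dd_def[abs_def])

declare Ck_on.simps(2) [simp del]

lemma Ck_on_cong:
  assumes "open S" "\<And>x. x \<in> S \<Longrightarrow> f x = g x" "Ck_on k S f"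
  shows "Ck_on k S g"
  using assms(2,3)
proof (induction k arbitrary: f g)
  case 0
  then show ?case by (simp cong: continuous_on_cong)
next
  case (Suc k)
  have fd: "f differentiable_on S" and k: "\<And>b. b \<in> Basis \<Longrightarrow> Ck_on k S (dd b f)"
    using Suc.prems by (auto simp: Ck_on_Suc)
  have "g differentiable_on S"
    using fd Suc.prems(1) unfolding differentiable_on_def
    by (metis differentiable_transform_within zero_less_one)
  moreover have "Ck_on k S (dd b g)" if "b \<in> Basis" for b
    using Suc.IH[OF _ k[OF that]] dd_cong[OF assms(1) _ Suc.prems(1)] fd
    by (auto simp: differentiable_on_openD[OF _ assms(1)])
  ultimately show ?case by (simp add: Ck_on_Suc)
qed

lemma smooth_on_dd: "smooth_on S f \<Longrightarrow> b \<in> Basis \<Longrightarrow> smooth_on S (dd b f)"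
  unfolding smooth_on_def
proof
  fix k assume "\<forall>k. Ck_on k S f" "b \<in> Basis"
  then have "Ck_on (Suc k) S f" by blast
  with \<open>b \<in> Basis\<close> show "Ck_on k S (dd b f)" by (simp add: Ck_on_Suc)
qed

lemma smooth_on_differentiable: "smooth_on S f \<Longrightarrow> f differentiable_on S"
  unfolding smooth_on_def by (metis Ck_on_Suc)

lemma smooth_on_continuous: "smooth_on S f \<Longrightarrow> continuous_on S f"
  unfolding smooth_on_def by (metis Ck_on.simps(1))

text \<open>A fixed bounded linear map commutes with differentiation, so the induction passes to
  \<open>dd b f\<close>. It is meant for coordinate projections, which turn smooth vector fields
  into smooth scalar components.\<close>

lemma Ck_on_bounded_linear:
  assumes L: "bounded_linear L" and S: "open S" and "Ck_on k S f"
  shows "Ck_on k S (\<lambda>x. L (f x))"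
  using assms(3)
proof (induction k arbitrary: f)
  case 0
  then show ?case
    using linear_continuous_on_compose L by (simp add: bounded_linear.continuous_on)
next
  case (Suc k)
  have fd: "f differentiable (at x)" if "x \<in> S" for x
    using Suc.prems S that by (auto simp: Ck_on_Suc differentiable_on_openD)
  have hd: "((\<lambda>x. L (f x)) has_derivative (\<lambda>h. L (frechet_derivative f (at x) h))) (at x)" if "x \<in> S" for x
    using fd[OF that] by (intro bounded_linear.has_derivative[OF L]) (simp add: frechet_derivative_works)
  have eq: "L (dd b f x) = dd b (\<lambda>x. L (f x)) x" if "x \<in> S" for x b
    using dd_eq[OF hd[OF that], of b] by (simp add: dd_def)
  have "(\<lambda>x. L (f x)) differentiable_on S"
    using hd S by (auto simp: differentiable_on_eq_differentiable_at differentiable_def)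
  moreover have "Ck_on k S (dd b (\<lambda>x. L (f x)))" if "b \<in> Basis" for b
    by (rule Ck_on_cong[OF S eq Suc.IH]) (use Suc.prems that in \<open>auto simp: Ck_on_Suc\<close>)
  ultimately show ?case by (simp add: Ck_on_Suc)
qed

lemma smooth_on_dd_commute:
  fixes f :: "'a::euclidean_space \<Rightarrow> real"
  assumes "open S" "x \<in> S" "smooth_on S f" "a \<in> Basis" "b \<in> Basis"
  shows "dd b (dd a f) x = dd a (dd b f) x"
  using assms by (intro dd_commute) (auto intro!: smooth_on_differentiable smooth_on_continuous smooth_on_dd)

lemma pd_const [simp]: "pd j (\<lambda>_. c) x = 0"
  by (simp add: pd_def)

lemma pd_diff:
  assumes "f differentiable (at x)" "h differentiable (at x)"
  shows "pd j (\<lambda>x. f x - h x) x = pd j f x - pd j h x"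
proof -
  have "((\<lambda>x. f x - h x) has_derivative
     (\<lambda>v. frechet_derivative f (at x) v - frechet_derivative h (at x) v)) (at x)"
    using assms by (intro has_derivative_diff) (simp_all add: frechet_derivative_works)
  from dd_eq[OF this] show ?thesis by (simp add: pd_eq_dd) (simp add: dd_def)
qed

lemma pd_cong:
  assumes "open V" "x \<in> V" "\<And>y. y \<in> V \<Longrightarrow> f y = g y" "f differentiable (at x)"
  shows "pd j g x = pd j f x"
  using dd_cong[OF assms] by (simp add: pd_eq_dd)

lemma differentiable_at_cong:
  assumes "open V" "x \<in> V" "\<And>y. y \<in> V \<Longrightarrow> f y = g y" "f differentiable (at x)"
  shows "g differentiable (at x)"
  using assms by (meson differentiable_def has_derivative_transform_within_open)

lemma C1_cong:
  assumes V: "open V" and eq: "\<And>y. y \<in> V \<Longrightarrow> f y = g y" and f: "C1 V f"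
  shows "C1 V g"
proof -
  have d: "f differentiable (at x)" if "x \<in> V" for x
    using f V that by (auto simp: C1_def intro: differentiable_on_openD)
  have "continuous_on V (pd j g)" for j
    using f pd_cong[OF V _ eq d] by (subst continuous_on_cong[of V V _ "pd j f"]) (auto simp: C1_def)
  moreover have "g differentiable_on V"
    unfolding differentiable_on_eq_differentiable_at[OF V] using differentiable_at_cong[OF V _ eq d] by blast
  ultimately show ?thesis by (simp add: C1_def)
qed

lemma C1_Ck_on_Suc_0: "Ck_on (Suc 0) V f \<Longrightarrow> C1 V f"
  by (auto simp: C1_def Ck_on_Suc Basis_axis pd_eq_dd)

lemma Ck_on_2_C1:
  assumes "Ck_on 2 V f"
  shows "C1 V f" "C1 V (pd j f)"
proof -
  have f: "f differentiable_on V" and k: "Ck_on (Suc 0) V (pd i f)" for i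
    using assms by (auto simp: numeral_2_eq_2 Ck_on_Suc Basis_axis pd_eq_dd)
  show "C1 V (pd j f)" using k C1_Ck_on_Suc_0 by blast
  show "C1 V f" using f C1_continuous[OF C1_Ck_on_Suc_0[OF k]] by (simp add: C1_def)
qed

section \<open>Integration over bounded open sets\<close>

text \<open>Continuity on the compact closure makes \<open>f\<close> bounded, and a bounded open set
  has finite measure. This is the only source of integrability for the fields below.\<close>

lemma integrable_on_continuous_closure:
  fixes f :: "'a::euclidean_space \<Rightarrow> real"
  assumes "open \<Omega>" "bounded \<Omega>" "continuous_on (closure \<Omega>) f"
  shows "f integrable_on \<Omega>"
proof -
  have "compact (f ` closure \<Omega>)"
    using assms by (intro compact_continuous_image) auto
  then have "bounded (f ` closure \<Omega>)"
    by (rule compact_imp_bounded)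
  then obtain M where M: "\<And>x. x \<in> closure \<Omega> \<Longrightarrow> norm (f x) \<le> M"
    unfolding bounded_iff by blast
  have "\<Omega> \<in> lmeasurable"
    using assms by (simp add: lmeasurable_open)
  then have "\<Omega> \<in> sets lebesgue" "(\<lambda>_. M) integrable_on \<Omega>"
    by (simp_all add: fmeasurableD integrable_on_const)
  moreover have "f \<in> borel_measurable (lebesgue_on \<Omega>)"
    using assms by (intro continuous_imp_measurable_on_sets_lebesgue)
      (auto intro: continuous_on_subset[OF _ closure_subset])
  ultimately show ?thesis
    using M closure_subset[of \<Omega>]
    by (intro measurable_bounded_by_integrable_imp_integrable[of f \<Omega> "\<lambda>_. M"]) auto
qed

text \<open>The mean value theorem bounds all difference quotients by \<open>M\<close>, so dominated
  convergence applies along every sequence of increments tending to 0.\<close>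

lemma has_real_derivative_integral:
  fixes F :: "real \<Rightarrow> 'a::euclidean_space \<Rightarrow> real"
  assumes d: "d > 0" and S: "(\<lambda>_. M::real) integrable_on S"
    and int: "\<And>s. \<bar>s - t\<bar> < d \<Longrightarrow> F s integrable_on S"
    and der: "\<And>s x. \<bar>s - t\<bar> < d \<Longrightarrow> x \<in> S \<Longrightarrow> ((\<lambda>s. F s x) has_real_derivative F' s x) (at s)"
    and bd: "\<And>s x. \<bar>s - t\<bar> < d \<Longrightarrow> x \<in> S \<Longrightarrow> \<bar>F' s x\<bar> \<le> M"
  shows "((\<lambda>s. integral S (F s)) has_real_derivative integral S (F' t)) (at t)"
  unfolding DERIV_def LIMSEQ_SEQ_conv[symmetric]
proof (intro allI impI, elim conjE)
  fix X :: "nat \<Rightarrow> real" assume X: "\<forall>n. X n \<noteq> 0" "X \<longlonglongrightarrow> 0"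
  \<comment> \<open>Dropping the first \<open>N\<close> terms brings every increment within the
    range \<open>d\<close> where the hypotheses hold.\<close>
  obtain N where N: "\<And>n. n \<ge> N \<Longrightarrow> \<bar>X n\<bar> < d"
    using LIMSEQ_D[OF X(2) d] by auto
  let ?Y = "\<lambda>n. X (n + N)"
  have Y: "?Y n \<noteq> 0" "\<bar>?Y n\<bar> < d" for n using X N by auto
  have "(\<lambda>n. integral S (\<lambda>x. (F (t + ?Y n) x - F t x) / ?Y n)) \<longlonglongrightarrow> integral S (F' t)"
  proof (rule dominated_convergence(2)[OF _ S])
    fix n
    show "(\<lambda>x. (F (t + ?Y n) x - F t x) / ?Y n) integrable_on S"
      using int[of t] int[of "t + ?Y n"] Y[of n] d
      by (intro integrable_on_divide integrable_diff) auto
  next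
    fix n x assume x: "x \<in> S"
    have "\<bar>F (t + ?Y n) x - F t x\<bar> \<le> M * \<bar>?Y n\<bar>"
    proof -
      have "norm (F (t + ?Y n) x - F t x) \<le> M * norm (t + ?Y n - t)"
      proof (rule field_differentiable_bound[of "ball t d" "\<lambda>s. F s x" "\<lambda>s. F' s x"])
        fix z assume "z \<in> ball t d"
        then have "\<bar>z - t\<bar> < d" by (simp add: dist_real_def)
        then show "((\<lambda>s. F s x) has_field_derivative F' z x) (at z within ball t d)" "norm (F' z x) \<le> M"
          using der bd x by (auto intro: has_field_derivative_at_within)
      qed (use d Y in \<open>auto simp: dist_real_def\<close>)
      then show ?thesis by simp
    qed
    then show "norm ((F (t + ?Y n) x - F t x) / ?Y n) \<le> M"
      using Y[of n] by (simp add: divide_le_eq)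
  next
    fix x assume "x \<in> S"
    then have "((\<lambda>h. (F (t + h) x - F t x) / h) \<longlongrightarrow> F' t x) (at 0)"
      using der[of t x] d by (simp add: DERIV_def)
    then show "(\<lambda>n. (F (t + ?Y n) x - F t x) / ?Y n) \<longlonglongrightarrow> F' t x"
      using LIMSEQ_ignore_initial_segment[OF X(2), of N] Y(1)
      unfolding LIMSEQ_SEQ_conv[symmetric] by (elim allE[of _ ?Y]) simp
  qed
  moreover have eq: "integral S (\<lambda>x. (F (t + ?Y n) x - F t x) / ?Y n)
      = (integral S (F (t + ?Y n)) - integral S (F t)) / ?Y n" for n
    using integral_diff[of "F (t + ?Y n)" S "F t"] int[of t] int[of "t + ?Y n"] Y[of n] d by simp
  ultimately have "(\<lambda>n. (integral S (F (t + X (n + N))) - integral S (F t)) / X (n + N)) \<longlonglongrightarrow> integral S (F' t)"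
    by (simp only: eq)
  then show "(\<lambda>n. (integral S (F (t + X n)) - integral S (F t)) / X n) \<longlonglongrightarrow> integral S (F' t)"
    by (rule LIMSEQ_offset)
qed

text \<open>Translating \<open>K\<close> along \<open>e\<close> does not change its integral, so the derivative of the
  translated integral vanishes.\<close>

lemma integral_directional_derivative_eq_0:
  fixes K :: "'a::euclidean_space \<Rightarrow> real"
  assumes e: "e \<in> Basis" and \<Omega>: "bounded \<Omega>" and K: "K integrable_on \<Omega>"
    and zero: "\<And>x. x \<notin> \<Omega> \<Longrightarrow> K x = 0" "\<And>x. x \<notin> \<Omega> \<Longrightarrow> K' x = 0"
    and der: "\<And>x. ((\<lambda>s. K (x + s *\<^sub>R e)) has_real_derivative K' x) (at 0)"
    and bd: "\<And>x. \<bar>K' x\<bar> \<le> M"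
  shows "integral \<Omega> K' = 0"
proof -
  obtain a where a: "\<Omega> \<subseteq> cbox (-a) a"
    using bounded_subset_cbox_symmetric[OF \<Omega>] by auto
  \<comment> \<open>The margin \<open>One\<close> leaves room for every translation by less than 1,
    so the domain of integration can stay fixed.\<close>
  let ?B = "cbox (-a - One) (a + One)"
  have sub: "\<Omega> \<subseteq> cbox (- a - One + s *\<^sub>R e) (a + One + s *\<^sub>R e)" if "\<bar>s\<bar> < 1" for s
  proof
    fix x assume "x \<in> \<Omega>"
    then have x: "x \<in> cbox (-a) a" using a by auto
    have "\<bar>s * (e \<bullet> i)\<bar> \<le> 1" if "i \<in> Basis" for i
      using e that \<open>\<bar>s\<bar> < 1\<close> by (simp add: inner_Basis)
    then show "x \<in> cbox (- a - One + s *\<^sub>R e) (a + One + s *\<^sub>R e)"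
      using x by (simp add: mem_box inner_add_left inner_diff_left) (smt (verit))
  qed
  have shift: "((\<lambda>x. K (x + s *\<^sub>R e)) has_integral integral \<Omega> K) ?B" if "\<bar>s\<bar> < 1" for s
  proof -
    have "(K has_integral integral \<Omega> K) (cbox (- a - One + s *\<^sub>R e) (a + One + s *\<^sub>R e))"
      by (rule has_integral_on_superset[OF integrable_integral[OF K] _ sub[OF that]]) (use zero in auto)
    then show ?thesis
      using has_integral_shift_cbox_iff[of K "s *\<^sub>R e"] by (simp add: o_def add.commute)
  qed
  have "((\<lambda>s. integral ?B (\<lambda>x. K (x + s *\<^sub>R e))) has_real_derivative
      integral ?B (\<lambda>x. K' (x + 0 *\<^sub>R e))) (at 0)"
  proof (rule has_real_derivative_integral[where d = 1 and M = M and F' = "\<lambda>s x. K' (x + s *\<^sub>R e)"])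
    fix s :: real and x
    show "((\<lambda>s. K (x + s *\<^sub>R e)) has_real_derivative K' (x + s *\<^sub>R e)) (at s)"
      using der[of "x + s *\<^sub>R e"] DERIV_shift[of "\<lambda>s. K (x + s *\<^sub>R e)" "K' (x + s *\<^sub>R e)" 0 s]
      by (simp add: algebra_simps)
  qed (use shift bd in \<open>auto simp: has_integral_integrable\<close>)
  \<comment> \<open>For small shifts the integral over the fixed box is the constant
    \<open>integral \<Omega> K\<close>, whose derivative is 0.\<close>
  then have "((\<lambda>s. integral \<Omega> K) has_real_derivative integral ?B K') (at 0)"
    by (rule has_field_derivative_transform_within_open[where S = "{-1<..<1}", THEN DERIV_cong])
      (use shift in \<open>auto intro!: integral_unique\<close>)
  then have "integral ?B K' = 0"
    using DERIV_unique DERIV_const by blast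
  moreover have "integral ?B K' = integral \<Omega> K'"
  proof -
    have "\<Omega> \<subseteq> ?B" using sub[of 0] by simp
    then have "(\<lambda>x. if x \<in> \<Omega> then K' x else 0) = K'" "(\<lambda>x. if x \<in> ?B then K' x else 0) = K'"
      using zero(2) by (intro ext; metis subsetD)+
    then show ?thesis
      using integral_restrict_UNIV[of \<Omega> K'] integral_restrict_UNIV[of ?B K'] by simp
  qed
  ultimately show ?thesis by simp
qed

section \<open>The divergence theorem for tangential fields\<close>

lemma defining_fun_smooth:
  assumes "defining_fun \<Omega> \<rho>"
  shows "\<rho> differentiable (at x)" "C1 UNIV \<rho>" "C1 UNIV (pd j \<rho>)"
proof -
  have s: "smooth_on UNIV \<rho>" "smooth_on UNIV (pd i \<rho>)" "smooth_on UNIV (pd i (pd j \<rho>))" for i j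
    using assms by (auto simp: defining_fun_def pd_eq_dd Basis_axis intro!: smooth_on_dd)
  then show "C1 UNIV \<rho>" "C1 UNIV (pd j \<rho>)"
    by (auto simp: C1_def smooth_on_differentiable smooth_on_continuous)
  then show "\<rho> differentiable (at x)"
    by (auto simp: C1_def differentiable_on_def)
qed

lemma defining_fun_frontier:
  assumes \<rho>: "defining_fun \<Omega> \<rho>"
  shows "open \<Omega>" "x \<in> frontier \<Omega> \<Longrightarrow> \<rho> x = 0"
proof -
  have c: "continuous_on UNIV \<rho>" using defining_fun_smooth[OF \<rho>] C1_continuous by blast
  have eq: "\<Omega> = {x. \<rho> x < 0}" using \<rho> by (simp add: defining_fun_def)
  show o: "open \<Omega>"
    unfolding eq by (rule open_Collect_less[OF c]) auto
  have "closed {x. \<rho> x \<le> 0}"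
    by (rule closed_Collect_le[OF c]) auto
  then have "closure \<Omega> \<subseteq> {x. \<rho> x \<le> 0}"
    by (rule closure_minimal[rotated]) (auto simp: eq)
  then show "x \<in> frontier \<Omega> \<Longrightarrow> \<rho> x = 0"
    using o by (auto simp: frontier_def interior_open eq)
qed

section \<open>Functions vanishing on the boundary are dominated by the defining function\<close>

lemma C1_Lipschitz_cball:
  fixes G :: "real^'n \<Rightarrow> real"
  assumes V: "open V" "cball z r \<subseteq> V" and G: "C1 V G"
  obtains L where "L \<ge> 0" "\<And>x y. x \<in> cball z r \<Longrightarrow> y \<in> cball z r \<Longrightarrow> \<bar>G x - G y\<bar> \<le> L * norm (x - y)"
proof -
  have "continuous_on (cball z r) (grad G)"
    unfolding grad_def using G V(2)
    by (intro continuous_on_vec_lambda) (auto simp: C1_def intro: continuous_on_subset)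
  then have "bounded (grad G ` cball z r)"
    by (intro compact_imp_bounded compact_continuous_image) auto
  then obtain L where L: "\<And>x. x \<in> cball z r \<Longrightarrow> norm (grad G x) \<le> L" and L0: "L > 0"
    unfolding bounded_pos by (meson imageI)
  have "\<bar>G x - G y\<bar> \<le> L * norm (x - y)" if "x \<in> cball z r" "y \<in> cball z r" for x y
    unfolding real_norm_def[symmetric]
  proof (rule differentiable_bound[OF convex_cball _ _ that])
    fix x assume x: "x \<in> cball z r"
    then have d: "G differentiable (at x)"
      using G V by (auto simp: C1_def intro: differentiable_on_openD)
    then show "(G has_derivative frechet_derivative G (at x)) (at x within cball z r)"
      by (simp add: frechet_derivative_works has_derivative_at_withinI)
    show "onorm (frechet_derivative G (at x)) \<le> L"
    proof (rule onorm_le)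
      fix h
      have "norm (frechet_derivative G (at x) h) \<le> norm (grad G x) * norm h"
        unfolding frechet_derivative_grad[OF d] real_norm_def by (rule Cauchy_Schwarz_ineq2)
      also have "\<dots> \<le> L * norm h" using L[OF x] by (rule mult_right_mono) simp
      finally show "norm (frechet_derivative G (at x) h) \<le> L * norm h" .
    qed
  qed
  with L0 show ?thesis by (intro that[of L]) auto
qed

text \<open>From \<open>x\<close> in \<Omega> near \<open>z\<close>, move along the gradient
  \<open>a\<close> of \<rho> at \<open>z\<close>. There \<rho> grows at a rate of at least half of
  \<open>(norm a)\<^sup>2\<close>, so the path leaves \<Omega> within a distance proportional to the
  size of \<rho> at \<open>x\<close>. It crosses the frontier, where \<open>G\<close> is 0, and the
  Lipschitz bound for \<open>G\<close> does the rest.\<close>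

lemma bounded_ratio_near_frontier:
  fixes G :: "real^'n \<Rightarrow> real"
  assumes \<rho>: "defining_fun \<Omega> \<rho>" and V: "open V" "closure \<Omega> \<subseteq> V" and G: "C1 V G"
    and G0: "\<And>x. x \<in> frontier \<Omega> \<Longrightarrow> G x = 0" and z: "z \<in> frontier \<Omega>"
  shows "\<exists>r>0. \<exists>C\<ge>0. \<forall>x\<in>ball z r \<inter> \<Omega>. \<bar>G x\<bar> \<le> C * \<bar>\<rho> x\<bar>"
proof -
  define a where "a = grad \<rho> z"
  have z0: "\<rho> z = 0" using defining_fun_frontier[OF \<rho>] z by blast
  then have a: "norm a > 0" using \<rho> by (simp add: defining_fun_def a_def)
  have c: "continuous_on UNIV (\<lambda>y. grad \<rho> y \<bullet> a)"
    unfolding grad_def using defining_fun_smooth[OF \<rho>]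
    by (intro continuous_on_inner continuous_on_vec_lambda) (auto simp: C1_def)
  have "grad \<rho> z \<bullet> a > (norm a)\<^sup>2 / 2"
    using a by (simp add: a_def dot_square_norm)
  then have "z \<in> {y. (norm a)\<^sup>2 / 2 < grad \<rho> y \<bullet> a} \<inter> V"
    using z V by (auto simp: frontier_def)
  moreover have "open ({y. (norm a)\<^sup>2 / 2 < grad \<rho> y \<bullet> a} \<inter> V)"
    by (intro open_Int open_Collect_less c V) auto
  ultimately obtain r1 where r1: "r1 > 0" "cball z r1 \<subseteq> {y. (norm a)\<^sup>2 / 2 < grad \<rho> y \<bullet> a} \<inter> V"
    unfolding open_contains_cball by blast
  obtain L where L: "L \<ge> 0" "\<And>x y. x \<in> cball z r1 \<Longrightarrow> y \<in> cball z r1 \<Longrightarrow> \<bar>G x - G y\<bar> \<le> L * norm (x - y)"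
    using C1_Lipschitz_cball[OF V(1) _ G, of z r1] r1 by blast
  have "isCont \<rho> z"
    using defining_fun_smooth[OF \<rho>] differentiable_imp_continuous_within by blast
  \<comment> \<open>The bound \<open>r1 * norm a / 4\<close> makes the path, whose length is twice
    the size of \<open>\<rho> x\<close> divided by \<open>norm a\<close>, shorter than
    \<open>r1 / 2\<close>.\<close>
  then obtain r3 where r3: "r3 > 0" "\<And>x. dist x z < r3 \<Longrightarrow> \<bar>\<rho> x\<bar> < r1 * norm a / 4"
    unfolding continuous_at_eps_delta using z0 r1(1) a
    by (metis diff_zero dist_real_def mult_pos_pos zero_less_divide_iff zero_less_numeral)
  have "\<bar>G x\<bar> \<le> (L * 2 / norm a) * \<bar>\<rho> x\<bar>" if x: "x \<in> ball z (min (r1/2) r3) \<inter> \<Omega>" for x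
  proof -
    have neg: "\<rho> x < 0" using x \<rho> by (auto simp: defining_fun_def)
    \<comment> \<open>The time after which growth at rate \<open>(norm a)\<^sup>2 / 2\<close> has
      used up the negative value \<open>\<rho> x\<close>.\<close>
    define s where "s = 2 * \<bar>\<rho> x\<bar> / (norm a)\<^sup>2"
    have s: "s > 0" using neg a by (simp add: s_def divide_neg_pos)
    have sa: "s * norm a = 2 * \<bar>\<rho> x\<bar> / norm a" using a by (simp add: s_def power2_eq_square)
    have "\<bar>\<rho> x\<bar> < r1 * norm a / 4" using x r3(2)[of x] by (simp add: dist_commute)
    then have small: "s * norm a < r1 / 2"
      using a unfolding sa by (simp add: divide_less_eq)
    have xb: "x \<in> cball z r1" using x r1(1) by auto
    have seg: "x + t *\<^sub>R a \<in> cball z r1" if "0 \<le> t" "t \<le> s" for t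
    proof -
      have "norm (t *\<^sub>R a) \<le> s * norm a" using that by (simp add: mult_right_mono)
      moreover have "dist z (x + t *\<^sub>R a) \<le> dist z x + norm (t *\<^sub>R a)"
        by (metis add_diff_cancel_left' dist_commute dist_norm dist_triangle norm_minus_commute)
      ultimately show ?thesis using small x by auto
    qed
    have "\<exists>t>0. t < s \<and> \<rho> (x + s *\<^sub>R a) - \<rho> (x + 0 *\<^sub>R a) = (s - 0) * (dd a \<rho> (x + t *\<^sub>R a))"
      by (rule MVT2[OF s]) (intro dd_line defining_fun_smooth[OF \<rho>])
    then obtain t where t: "0 < t" "t < s" "\<rho> (x + s *\<^sub>R a) - \<rho> x = s * dd a \<rho> (x + t *\<^sub>R a)"
      by auto
    have "dd a \<rho> (x + t *\<^sub>R a) > (norm a)\<^sup>2 / 2"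
      using seg[of t] t r1(2) frechet_derivative_grad[OF defining_fun_smooth(1)[OF \<rho>]]
      by (auto simp: dd_def)
    then have "s * dd a \<rho> (x + t *\<^sub>R a) \<ge> s * ((norm a)\<^sup>2 / 2)" using s by simp
    also have "s * ((norm a)\<^sup>2 / 2) = \<bar>\<rho> x\<bar>" using a by (simp add: s_def)
    finally have "\<rho> (x + s *\<^sub>R a) \<ge> 0" using t(3) neg by simp
    then have "x + s *\<^sub>R a \<notin> \<Omega>" using \<rho> by (simp add: defining_fun_def)
    \<comment> \<open>A segment is connected, so one that starts in \<Omega> and ends outside meets
      the frontier.\<close>
    then obtain y where y: "y \<in> closed_segment x (x + s *\<^sub>R a)" "y \<in> frontier \<Omega>"
      using connected_Int_frontier[of "closed_segment x (x + s *\<^sub>R a)" \<Omega>] x by auto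
    then obtain k where k: "0 \<le> k" "k \<le> 1" "y = x + (k * s) *\<^sub>R a"
      by (auto simp: closed_segment_def algebra_simps)
    have ks: "0 \<le> k * s" "k * s \<le> s" using k s by (simp_all add: mult_left_le_one_le)
    have "\<bar>G x\<bar> = \<bar>G x - G y\<bar>" using G0[OF y(2)] by simp
    also have "\<dots> \<le> L * norm (x - y)"
      using L(2)[OF xb seg[OF ks]] k by simp
    also have "norm (x - y) \<le> s * norm a"
      using k ks s by (simp add: mult_right_mono)
    finally show ?thesis using L(1) by (simp add: sa mult_left_mono)
  qed
  moreover have "L * 2 / norm a \<ge> 0" using L(1) by simp
  ultimately show ?thesis using r1 r3 by (intro exI[of _ "min (r1/2) r3"]) auto
qed

text \<open>Near an interior point \<rho> stays away from 0 and \<open>G\<close> is bounded; near a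
  frontier point the local estimate applies. Finitely many such balls cover the compact closure, and
  the sum of their constants serves for all.\<close>

lemma bounded_ratio:
  fixes G :: "real^'n \<Rightarrow> real"
  assumes \<rho>: "defining_fun \<Omega> \<rho>" and \<Omega>: "bounded \<Omega>" and V: "open V" "closure \<Omega> \<subseteq> V" and G: "C1 V G"
    and G0: "\<And>x. x \<in> frontier \<Omega> \<Longrightarrow> G x = 0"
  obtains C where "C \<ge> 0" "\<And>x. x \<in> \<Omega> \<Longrightarrow> \<bar>G x\<bar> \<le> C * \<bar>\<rho> x\<bar>"
proof -
  have "\<exists>r>0. \<exists>C\<ge>0. \<forall>x\<in>ball z r \<inter> \<Omega>. \<bar>G x\<bar> \<le> C * \<bar>\<rho> x\<bar>" if z: "z \<in> closure \<Omega>" for z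
  proof (cases "z \<in> \<Omega>")
    case True
    then have zn: "\<rho> z < 0" using \<rho> by (simp add: defining_fun_def)
    have c: "isCont \<rho> z"
      using defining_fun_smooth[OF \<rho>] differentiable_imp_continuous_within by blast
    have cG: "isCont G z"
      using C1_continuous[OF G] V z by (auto simp: continuous_on_eq_continuous_at)
    obtain r1 where r1: "r1 > 0" "\<And>x. dist x z < r1 \<Longrightarrow> \<bar>\<rho> x - \<rho> z\<bar> < \<bar>\<rho> z\<bar> / 2"
      using c zn unfolding continuous_at_eps_delta dist_real_def
      by (metis zero_less_abs_iff half_gt_zero less_irrefl)
    obtain r2 where r2: "r2 > 0" "\<And>x. dist x z < r2 \<Longrightarrow> \<bar>G x - G z\<bar> < 1"
      using cG unfolding continuous_at_eps_delta dist_real_def by (metis zero_less_one)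
    let ?C = "(\<bar>G z\<bar> + 1) / (\<bar>\<rho> z\<bar> / 2)"
    have "\<bar>G x\<bar> \<le> ?C * \<bar>\<rho> x\<bar>" if "x \<in> ball z (min r1 r2)" for x
    proof -
      have "\<bar>\<rho> x\<bar> \<ge> \<bar>\<rho> z\<bar> / 2" "\<bar>G x\<bar> \<le> \<bar>G z\<bar> + 1"
        using r1(2)[of x] r2(2)[of x] that zn by (auto simp: dist_commute abs_if split: if_splits)
      moreover have "?C * (\<bar>\<rho> z\<bar> / 2) \<le> ?C * \<bar>\<rho> x\<bar>"
        using calculation by (intro mult_left_mono) auto
      moreover have "?C * (\<bar>\<rho> z\<bar> / 2) = \<bar>G z\<bar> + 1" using zn by (simp add: field_simps)
      ultimately show ?thesis by linarith
    qed
    then show ?thesis using r1(1) r2(1)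
      by (intro exI[of _ "min r1 r2"] conjI exI[of _ ?C]) (auto simp del: times_divide_eq_left)
  next
    case False
    then have "z \<in> frontier \<Omega>"
      using z defining_fun_frontier(1)[OF \<rho>] by (simp add: frontier_def interior_open)
    then show ?thesis using bounded_ratio_near_frontier[OF \<rho> V G G0] by blast
  qed
  then obtain r C where rC: "\<And>z. z \<in> closure \<Omega> \<Longrightarrow> r z > 0" "\<And>z. z \<in> closure \<Omega> \<Longrightarrow> C z \<ge> 0"
    "\<And>z x. z \<in> closure \<Omega> \<Longrightarrow> x \<in> ball z (r z) \<inter> \<Omega> \<Longrightarrow> \<bar>G x\<bar> \<le> C z * \<bar>\<rho> x\<bar>"
    by metis
  have "compact (closure \<Omega>)" using \<Omega> by simp
  then obtain Z where Z: "Z \<subseteq> closure \<Omega>" "finite Z" "closure \<Omega> \<subseteq> (\<Union>z\<in>Z. ball z (r z))"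
    by (rule compactE_image[of _ "closure \<Omega>" "\<lambda>z. ball z (r z)"]) (use rC(1) in force)+
  have "\<bar>G x\<bar> \<le> sum C Z * \<bar>\<rho> x\<bar>" if x: "x \<in> \<Omega>" for x
  proof -
    obtain z where z: "z \<in> Z" "x \<in> ball z (r z)"
      using Z x closure_subset[of \<Omega>] by blast
    have "\<bar>G x\<bar> \<le> C z * \<bar>\<rho> x\<bar>" using rC(3)[of z x] z Z x by auto
    also have "C z \<le> sum C Z" using Z z rC(2) by (intro member_le_sum) auto
    finally show ?thesis by (simp add: mult_right_mono)
  qed
  moreover have "sum C Z \<ge> 0" using Z rC(2) by (intro sum_nonneg) auto
  ultimately show ?thesis using that by blast
qed

lemma bounded_on_closure:
  fixes f :: "'a::euclidean_space \<Rightarrow> real"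
  assumes "bounded \<Omega>" "continuous_on (closure \<Omega>) f"
  obtains M where "\<And>x. x \<in> closure \<Omega> \<Longrightarrow> \<bar>f x\<bar> \<le> M"
proof -
  have "bounded (f ` closure \<Omega>)"
    using assms by (intro compact_imp_bounded compact_continuous_image) auto
  then show ?thesis
    using that unfolding bounded_iff by (metis imageI real_norm_def)
qed

section \<open>Cutoff at the boundary and passage to the limit\<close>

text \<open>If \<open>\<rho> x\<close> is 0, then \<rho> is of order \<open>h\<close> along the
  line, so the weight is of order \<open>h\<^sup>2\<close>; with \<open>f\<close> bounded, the
  difference quotient tends to 0 however often the line enters and leaves \<Omega>. If
  \<open>\<rho> x\<close> is positive, the extension is zero near \<open>x\<close>.\<close>

lemma cutoff_extension_derivative_0:
  fixes f :: "real^'n \<Rightarrow> real"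
  assumes \<rho>: "defining_fun \<Omega> \<rho>" and x: "x \<notin> \<Omega>" and eps: "\<epsilon> > 0"
    and M: "\<And>y. y \<in> \<Omega> \<Longrightarrow> \<bar>f y\<bar> \<le> M"
  shows "((\<lambda>s. if x + s *\<^sub>R e \<in> \<Omega> then (\<rho> (x + s *\<^sub>R e))\<^sup>2 / (\<epsilon> + (\<rho> (x + s *\<^sub>R e))\<^sup>2) * f (x + s *\<^sub>R e) else 0)
    has_real_derivative 0) (at 0)" (is "(?K has_real_derivative 0) (at 0)")
proof -
  have mem: "y \<in> \<Omega> \<longleftrightarrow> \<rho> y < 0" for y using \<rho> by (simp add: defining_fun_def)
  have line: "((\<lambda>s. \<rho> (x + s *\<^sub>R e)) has_real_derivative dd e \<rho> (x + 0 *\<^sub>R e)) (at 0)"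
    by (rule dd_line[OF defining_fun_smooth(1)[OF \<rho>]])
  have K0: "?K 0 = 0" using x by simp
  have "\<not> \<rho> x < 0" using x mem by blast
  then consider "\<rho> x = 0" | "\<rho> x > 0" by linarith
  then show ?thesis
  proof cases
    case 1
    have q: "((\<lambda>h. \<rho> (x + h *\<^sub>R e) / h) \<longlongrightarrow> dd e \<rho> x) (at 0)"
      using line 1 by (simp add: DERIV_def)
    have "((\<lambda>h. \<bar>M\<bar> / \<epsilon> * (\<bar>h\<bar> * (\<rho> (x + h *\<^sub>R e) / h)\<^sup>2)) \<longlongrightarrow> \<bar>M\<bar> / \<epsilon> * (\<bar>0\<bar> * (dd e \<rho> x)\<^sup>2)) (at 0)"
      by (intro tendsto_intros q)
    then have lim: "((\<lambda>h. \<bar>M\<bar> / \<epsilon> * (\<bar>h\<bar> * (\<rho> (x + h *\<^sub>R e) / h)\<^sup>2)) \<longlongrightarrow> 0) (at 0)" by simp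
    have "\<bar>?K h / h\<bar> \<le> \<bar>M\<bar> / \<epsilon> * (\<bar>h\<bar> * (\<rho> (x + h *\<^sub>R e) / h)\<^sup>2)" if "h \<noteq> 0" for h
    proof -
      let ?r = "\<rho> (x + h *\<^sub>R e)"
      have "\<bar>?K h\<bar> \<le> ?r\<^sup>2 / \<epsilon> * \<bar>M\<bar>"
      proof (cases "x + h *\<^sub>R e \<in> \<Omega>")
        case True
        have "?r\<^sup>2 / (\<epsilon> + ?r\<^sup>2) \<le> ?r\<^sup>2 / \<epsilon>"
          using eps by (intro divide_left_mono mult_pos_pos) (auto simp: add_pos_nonneg)
        moreover have "\<bar>f (x + h *\<^sub>R e)\<bar> \<le> \<bar>M\<bar>" using M[OF True] by linarith
        moreover have "\<bar>?K h\<bar> = ?r\<^sup>2 / (\<epsilon> + ?r\<^sup>2) * \<bar>f (x + h *\<^sub>R e)\<bar>"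
          using True eps by (simp add: abs_mult add_pos_nonneg)
        ultimately show ?thesis using eps by (simp only:) (intro mult_mono; simp)
      qed (use eps in simp)
      then have "\<bar>?K h\<bar> / \<bar>h\<bar> \<le> ?r\<^sup>2 / \<epsilon> * \<bar>M\<bar> / \<bar>h\<bar>"
        by (rule divide_right_mono) simp
      also have "\<dots> = \<bar>M\<bar> / \<epsilon> * (\<bar>h\<bar> * (?r / h)\<^sup>2)"
        using that by (cases "h > 0") (auto simp: power2_eq_square field_simps)
      finally show ?thesis by (simp only: abs_divide)
    qed
    then have "((\<lambda>h. ?K h / h) \<longlongrightarrow> 0) (at 0)"
      by (intro tendsto_rabs_zero_cancel[OF tendsto_sandwich[OF _ _ tendsto_const lim]])
         (auto simp: eventually_at_filter simp del: abs_divide)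
    then show ?thesis unfolding DERIV_def K0 by (simp cong: if_cong)
  next
    case 2
    have "continuous_on UNIV \<rho>"
      using C1_continuous defining_fun_smooth[OF \<rho>] by blast
    then have "continuous_on UNIV (\<lambda>s. \<rho> (x + s *\<^sub>R e))"
      by (rule continuous_on_compose2) (auto intro!: continuous_intros)
    then have "open {s. 0 < \<rho> (x + s *\<^sub>R e)}"
      by (intro open_Collect_less) auto
    then show ?thesis
      by (rule has_field_derivative_transform_within_open[OF DERIV_const]) (use 2 mem in auto)
  qed
qed

text \<open>\<open>E\<close> is the product rule for the derivative along axis \<open>i\<close> of
  the weight times \<open>f\<close>; the factor in its second summand comes from differentiating
  \<open>r\<^sup>2 / (\<epsilon> + r\<^sup>2)\<close> in \<open>r\<close>. Extended by zero, the
  product is differentiable along the axis everywhere, so translation invariance gives integral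
  0.\<close>

lemma integral_cutoff_derivative:
  fixes f :: "real^'n \<Rightarrow> real" and i :: 'n
  assumes \<rho>: "defining_fun \<Omega> \<rho>" and \<Omega>: "bounded \<Omega>" and V: "open V" "closure \<Omega> \<subseteq> V"
    and f: "C1 V f" and eps: "\<epsilon> > 0"
  defines "E \<equiv> (\<lambda>x. (\<rho> x)\<^sup>2 / (\<epsilon> + (\<rho> x)\<^sup>2) * pd i f x
      + 2 * \<epsilon> * \<rho> x / (\<epsilon> + (\<rho> x)\<^sup>2)\<^sup>2 * (pd i \<rho> x * f x))"
  shows "E integrable_on \<Omega>" "integral \<Omega> E = 0"
proof -
  note open\<Omega> = defining_fun_frontier(1)[OF \<rho>]
  have pos: "\<epsilon> + (\<rho> x)\<^sup>2 > 0" for x using eps by (simp add: add_pos_nonneg)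
  have nz: "\<epsilon> + (\<rho> x)\<^sup>2 \<noteq> 0" for x using pos[of x] by simp
  have c\<rho>: "continuous_on (closure \<Omega>) \<rho>" "continuous_on (closure \<Omega>) (pd i \<rho>)"
    using defining_fun_smooth(2,3)[OF \<rho>] by (blast intro: C1_continuous C1_subset)+
  have cf: "continuous_on (closure \<Omega>) f" "continuous_on (closure \<Omega>) (pd i f)"
    using C1_continuous[OF f] f V(2) by (auto simp: C1_def intro: continuous_on_subset)
  have cE: "continuous_on (closure \<Omega>) E"
    unfolding E_def by (intro continuous_intros c\<rho> cf) (use nz in auto)
  then show "E integrable_on \<Omega>"
    by (rule integrable_on_continuous_closure[OF open\<Omega> \<Omega>])
  obtain M where M: "\<And>x. x \<in> closure \<Omega> \<Longrightarrow> \<bar>E x\<bar> \<le> M"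
    using bounded_on_closure[OF \<Omega> cE] by blast
  obtain Mf where Mf: "\<And>x. x \<in> closure \<Omega> \<Longrightarrow> \<bar>f x\<bar> \<le> Mf"
    using bounded_on_closure[OF \<Omega> cf(1)] by blast
  define K where "K = (\<lambda>x. if x \<in> \<Omega> then (\<rho> x)\<^sup>2 / (\<epsilon> + (\<rho> x)\<^sup>2) * f x else 0)"
  let ?K' = "\<lambda>x. if x \<in> \<Omega> then E x else 0"
  have "integral \<Omega> ?K' = 0"
  proof (rule integral_directional_derivative_eq_0[where K = K and e = "axis i 1" and M = "\<bar>M\<bar>"])
    have "(\<lambda>x. (\<rho> x)\<^sup>2 / (\<epsilon> + (\<rho> x)\<^sup>2) * f x) integrable_on \<Omega>"
      by (intro integrable_on_continuous_closure[OF open\<Omega> \<Omega>] continuous_intros c\<rho> cf) (use nz in auto)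
    then show "K integrable_on \<Omega>"
      by (rule integrable_eq) (simp add: K_def)
    fix x
    show "((\<lambda>s. K (x + s *\<^sub>R axis i 1)) has_real_derivative ?K' x) (at 0)"
    proof (cases "x \<in> \<Omega>")
      case False
      then show ?thesis
        unfolding K_def using cutoff_extension_derivative_0[OF \<rho> False eps, of f Mf "axis i 1"] Mf closure_subset[of \<Omega>]
        by auto
    next
      case True
      let ?e = "axis i (1::real) :: real^'n"
      have "x \<in> V" using True V closure_subset by blast
      then have "f differentiable (at (x + 0 *\<^sub>R ?e))"
        using f V by (auto simp: C1_def intro: differentiable_on_openD)
      from dd_line[OF this]
      have df: "((\<lambda>s. f (x + s *\<^sub>R ?e)) has_real_derivative pd i f x) (at 0)"
        by (simp add: pd_eq_dd)
      have d\<rho>: "((\<lambda>s. \<rho> (x + s *\<^sub>R ?e)) has_real_derivative pd i \<rho> x) (at 0)"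
        using dd_line[OF defining_fun_smooth(1)[OF \<rho>], where x = x and s = 0 and b = ?e] by (simp add: pd_eq_dd)
      let ?r = "\<lambda>s. \<rho> (x + s *\<^sub>R ?e)"
      have "((\<lambda>s. (?r s)\<^sup>2 / (\<epsilon> + (?r s)\<^sup>2)) has_real_derivative
          ((2 * pd i \<rho> x * \<rho> x) * (\<epsilon> + (\<rho> x)\<^sup>2) - (\<rho> x)\<^sup>2 * (2 * pd i \<rho> x * \<rho> x))
            / ((\<epsilon> + (\<rho> x)\<^sup>2) * (\<epsilon> + (\<rho> x)\<^sup>2))) (at 0)"
        using nz[of x] by (auto intro!: derivative_eq_intros d\<rho>)
      moreover have "((2 * pd i \<rho> x * \<rho> x) * (\<epsilon> + (\<rho> x)\<^sup>2) - (\<rho> x)\<^sup>2 * (2 * pd i \<rho> x * \<rho> x))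
            / ((\<epsilon> + (\<rho> x)\<^sup>2) * (\<epsilon> + (\<rho> x)\<^sup>2)) = 2 * \<epsilon> * \<rho> x / (\<epsilon> + (\<rho> x)\<^sup>2)\<^sup>2 * pd i \<rho> x"
        by (simp add: power2_eq_square algebra_simps)
      ultimately have d\<eta>: "((\<lambda>s. (?r s)\<^sup>2 / (\<epsilon> + (?r s)\<^sup>2)) has_real_derivative
          2 * \<epsilon> * \<rho> x / (\<epsilon> + (\<rho> x)\<^sup>2)\<^sup>2 * pd i \<rho> x) (at 0)" by simp
      have D: "((\<lambda>s. (\<rho> (x + s *\<^sub>R ?e))\<^sup>2 / (\<epsilon> + (\<rho> (x + s *\<^sub>R ?e))\<^sup>2) * f (x + s *\<^sub>R ?e))
          has_real_derivative E x) (at 0)"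
        using DERIV_mult[OF d\<eta> df] by (simp add: E_def algebra_simps)
      have "continuous_on UNIV (\<lambda>s. x + s *\<^sub>R ?e)" by (intro continuous_intros)
      then have "open ((\<lambda>s. x + s *\<^sub>R ?e) -` \<Omega>)"
        using open\<Omega> open_vimage by blast
      from has_field_derivative_transform_within_open[OF D this]
      show ?thesis using True by (auto simp: K_def)
    qed
    show "\<bar>?K' x\<bar> \<le> \<bar>M\<bar>" using M[of x] closure_subset[of \<Omega>] by (auto intro: order_trans)
  qed (auto simp: Basis_axis \<Omega> K_def)
  then show "integral \<Omega> E = 0"
    by (subst (asm) integral_cong[of _ _ E]) auto
qed

theorem integral_divg_tangential:
  fixes F :: "real^'n \<Rightarrow> real^'n"
  assumes \<rho>: "defining_fun \<Omega> \<rho>" and \<Omega>: "bounded \<Omega>" and V: "open V" "closure \<Omega> \<subseteq> V"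
    and F: "\<And>i. C1 V (\<lambda>x. F x $ i)"
    and tangential: "\<And>x. x \<in> frontier \<Omega> \<Longrightarrow> grad \<rho> x \<bullet> F x = 0"
  shows "integral \<Omega> (divg F) = 0"
proof -
  note open\<Omega> = defining_fun_frontier(1)[OF \<rho>]
  define G where "G = (\<lambda>x. \<Sum>i\<in>UNIV. pd i \<rho> x * F x $ i)"
  have G_eq: "G x = grad \<rho> x \<bullet> F x" for x
    by (simp add: G_def inner_vec_def grad_def)
  have "C1 V (pd i \<rho>)" for i
    using defining_fun_smooth(3)[OF \<rho>] by (blast intro: C1_subset)
  then have "C1 V G"
    unfolding G_def by (intro C1_sum C1_mult V F) auto
  then obtain C where C: "C \<ge> 0" "\<And>x. x \<in> \<Omega> \<Longrightarrow> \<bar>G x\<bar> \<le> C * \<bar>\<rho> x\<bar>"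
    by (rule bounded_ratio[OF \<rho> \<Omega> V]) (auto simp: G_eq tangential)
  have "continuous_on (closure \<Omega>) (divg F)"
    unfolding divg_def[abs_def] using F V(2)
    by (intro continuous_intros) (auto simp: C1_def intro: continuous_on_subset)
  then obtain M where M: "\<And>x. x \<in> closure \<Omega> \<Longrightarrow> \<bar>divg F x\<bar> \<le> M"
    using bounded_on_closure[OF \<Omega>] by blast
  \<comment> \<open>Summing the cutoff identity over all axes turns the normal parts
    \<open>pd i \<rho> x * F x $ i\<close> into \<open>G\<close>, the quantity that tangentiality
    controls.\<close>
  define E where "E = (\<lambda>\<epsilon> x. (\<rho> x)\<^sup>2 / (\<epsilon> + (\<rho> x)\<^sup>2) * divg F x + 2 * \<epsilon> * \<rho> x / (\<epsilon> + (\<rho> x)\<^sup>2)\<^sup>2 * G x)"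
  have E: "E \<epsilon> integrable_on \<Omega> \<and> integral \<Omega> (E \<epsilon>) = 0" if eps: "\<epsilon> > 0" for \<epsilon>
  proof -
    have "E \<epsilon> = (\<lambda>x. \<Sum>i\<in>UNIV. (\<rho> x)\<^sup>2 / (\<epsilon> + (\<rho> x)\<^sup>2) * pd i (\<lambda>x. F x $ i) x
      + 2 * \<epsilon> * \<rho> x / (\<epsilon> + (\<rho> x)\<^sup>2)\<^sup>2 * (pd i \<rho> x * F x $ i))"
      by (simp add: E_def G_def divg_def sum.distrib sum_distrib_left)
    then show ?thesis
      using integral_cutoff_derivative[OF \<rho> \<Omega> V F eps]
      by (simp add: integral_sum integrable_sum)
  qed
  define e where "e = (\<lambda>n. 1 / real (Suc n))"
  have e: "e n > 0" for n by (simp add: e_def)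
  have e0: "e \<longlonglongrightarrow> 0" unfolding e_def using LIMSEQ_inverse_real_of_nat by (simp add: inverse_eq_divide)
  have "(\<lambda>n. integral \<Omega> (E (e n))) \<longlonglongrightarrow> integral \<Omega> (divg F)"
  proof (rule dominated_convergence(2)[where h = "\<lambda>_. M + 2 * C"])
    show "E (e n) integrable_on \<Omega>" for n using E e by blast
    show "(\<lambda>_. M + 2 * C) integrable_on \<Omega>"
      using open\<Omega> \<Omega> by (intro integrable_on_continuous_closure continuous_intros)
  next
    fix n x assume x: "x \<in> \<Omega>"
    let ?s = "e n + (\<rho> x)\<^sup>2"
    have s: "?s > 0" using e[of n] by (simp add: add_pos_nonneg)
    have "(\<rho> x)\<^sup>2 / ?s * \<bar>divg F x\<bar> \<le> 1 * M"
      using s e[of n] M[of x] x closure_subset[of \<Omega>] by (intro mult_mono) (auto simp: less_imp_le)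
    moreover have "\<bar>2 * e n * \<rho> x / ?s\<^sup>2 * G x\<bar> \<le> 2 * C"
    proof -
      have "\<bar>2 * e n * \<rho> x / ?s\<^sup>2 * G x\<bar> = 2 * e n * \<bar>\<rho> x\<bar> / ?s\<^sup>2 * \<bar>G x\<bar>"
        using e[of n] by (simp add: abs_mult)
      also have "\<dots> \<le> 2 * e n * \<bar>\<rho> x\<bar> / ?s\<^sup>2 * (C * \<bar>\<rho> x\<bar>)"
        using C(2)[OF x] e[of n] by (intro mult_left_mono) auto
      also have "\<dots> = 2 * C * (e n * (\<rho> x)\<^sup>2 / ?s\<^sup>2)"
        by (simp add: power2_eq_square)
      also have "\<dots> \<le> 2 * C * 1"
      proof (intro mult_left_mono)
        \<comment> \<open>Each factor on the left is one of the two nonnegative summands of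
          \<open>?s\<close>. This bounds the error term uniformly in \<open>n\<close>, although the
          derivative of the weight alone is unbounded.\<close>
        have "e n * (\<rho> x)\<^sup>2 \<le> ?s * ?s"
          using e[of n] by (intro mult_mono) auto
        then show "e n * (\<rho> x)\<^sup>2 / ?s\<^sup>2 \<le> 1"
          using s by (simp add: power2_eq_square)
      qed (use C in auto)
      finally show ?thesis by simp
    qed
    moreover have "\<bar>(\<rho> x)\<^sup>2 / ?s * divg F x\<bar> = (\<rho> x)\<^sup>2 / ?s * \<bar>divg F x\<bar>"
      using s by (simp add: abs_mult)
    ultimately show "norm (E (e n) x) \<le> M + 2 * C"
      unfolding E_def real_norm_def by (smt (verit))
  next
    fix x assume "x \<in> \<Omega>"
    then have nz: "\<rho> x \<noteq> 0" using \<rho> by (auto simp: defining_fun_def)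
    have "(\<lambda>n. E (e n) x) \<longlonglongrightarrow> (\<rho> x)\<^sup>2 / (0 + (\<rho> x)\<^sup>2) * divg F x + 2 * 0 * \<rho> x / (0 + (\<rho> x)\<^sup>2)\<^sup>2 * G x"
      unfolding E_def by (intro tendsto_intros e0) (use nz in auto)
    then show "(\<lambda>n. E (e n) x) \<longlonglongrightarrow> divg F x" using nz by simp
  qed
  moreover have "integral \<Omega> (E (e n)) = 0" for n using E e by blast
  ultimately show ?thesis by (simp add: LIMSEQ_const_iff)
qed

text \<open>The form in which all integrations by parts are done: the divergence theorem for the
  product of \<open>p\<close> and \<open>v\<close>. The boundary hypothesis allows either a
  tangential \<open>v\<close> or a factor \<open>p\<close> that vanishes there.\<close>

corollary integral_scaled_tangential:
  fixes v :: "real^'n \<Rightarrow> real^'n"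
  assumes \<rho>: "defining_fun \<Omega> \<rho>" and \<Omega>: "bounded \<Omega>" and V: "open V" "closure \<Omega> \<subseteq> V"
    and p: "C1 V p" and v: "\<And>i. C1 V (\<lambda>x. v x $ i)"
    and tangential: "\<And>x. x \<in> frontier \<Omega> \<Longrightarrow> p x * (grad \<rho> x \<bullet> v x) = 0"
  shows "((\<lambda>x. grad p x \<bullet> v x + p x * divg v x) has_integral 0) \<Omega>"
proof -
  have "continuous_on (closure \<Omega>) p" "continuous_on (closure \<Omega>) (\<lambda>x. v x $ i)"
      "continuous_on (closure \<Omega>) (pd i p)" "continuous_on (closure \<Omega>) (pd i (\<lambda>x. v x $ j))" for i j
    using C1_continuous[OF C1_subset[OF p V(2)]] C1_continuous[OF C1_subset[OF v V(2)]]
      C1_subset[OF p V(2)] C1_subset[OF v V(2)] by (auto simp: C1_def)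
  then have "continuous_on (closure \<Omega>) (\<lambda>x. (\<Sum>j\<in>UNIV. pd j p x * v x $ j) + p x * (\<Sum>i\<in>UNIV. pd i (\<lambda>x. v x $ i) x))"
    by (intro continuous_on_add continuous_on_mult continuous_on_sum) auto
  then have "(\<lambda>x. grad p x \<bullet> v x + p x * divg v x) integrable_on \<Omega>"
    using integrable_on_continuous_closure[OF defining_fun_frontier(1)[OF \<rho>] \<Omega>]
    by (simp add: inner_vec_def grad_def divg_def)
  moreover
  have "integral \<Omega> (divg (\<lambda>x. p x *\<^sub>R v x)) = 0"
    using tangential by (intro integral_divg_tangential[OF \<rho> \<Omega> V]) (auto intro: C1_mult V p v)
  moreover have "divg (\<lambda>x. p x *\<^sub>R v x) x = grad p x \<bullet> v x + p x * divg v x" if "x \<in> \<Omega>" for x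
  proof -
    have "x \<in> V" using that V closure_subset by blast
    then have "p differentiable (at x)" "(\<lambda>x. v x $ i) differentiable (at x)" for i
      using p v V by (auto simp: C1_def intro: differentiable_on_openD)
    then show ?thesis
      by (simp add: divg_def pd_mult sum.distrib sum_distrib_left inner_vec_def grad_def add.commute)
  qed
  ultimately show ?thesis by (simp add: has_integral_integrable_integral cong: integral_cong)
qed

text \<open>By nonnegativity the integral over a closed box around \<open>x\<close> inside \<Omega>
  is also 0, and a continuous nonnegative function with zero integral over a box vanishes on
  it.\<close>

lemma has_integral_0_imp_0_open:
  fixes f :: "'a::euclidean_space \<Rightarrow> real"
  assumes \<Omega>: "open \<Omega>" "x \<in> \<Omega>" and f: "continuous_on \<Omega> f" and nonneg: "\<And>x. x \<in> \<Omega> \<Longrightarrow> f x \<ge> 0"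
    and int: "(f has_integral 0) \<Omega>"
  shows "f x = 0"
proof -
  obtain a b where ab: "cbox a b \<subseteq> \<Omega>" "x \<in> box a b"
    using \<Omega> by (meson open_contains_cbox)
  then have c: "continuous_on (cbox a b) f" using f continuous_on_subset by blast
  have "integral (cbox a b) f \<le> integral \<Omega> f"
    using ab nonneg int by (intro integral_subset_le integrable_continuous c) auto
  moreover have "integral (cbox a b) f \<ge> 0"
    using ab nonneg by (intro integral_nonneg integrable_continuous c) auto
  ultimately have "integral (cbox a b) f = 0" using int by (simp add: integral_unique)
  then show ?thesis
    using integral_cbox_eq_0_iff[OF c] ab nonneg box_subset_cbox by blast
qed

section \<open>The weak maximum principle for the heat equation\<close>

text \<open>At the maximum \<open>g' 0\<close> is 0. A positive \<open>D\<close> would make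
  \<open>g'\<close> positive just to the right, and then \<open>g\<close> would exceed
  \<open>g 0\<close>.\<close>

lemma second_derivative_nonpos_at_max:
  fixes g :: "real \<Rightarrow> real"
  assumes d: "d > 0" and g: "\<And>s. \<bar>s\<bar> < d \<Longrightarrow> (g has_real_derivative g' s) (at s)"
    and g': "(g' has_real_derivative D) (at 0)" and max: "\<And>s. \<bar>s\<bar> < d \<Longrightarrow> g s \<le> g 0"
  shows "D \<le> 0"
proof (rule ccontr)
  assume "\<not> D \<le> 0"
  then obtain c where c: "c > 0" "\<And>h. h > 0 \<Longrightarrow> h < c \<Longrightarrow> g' 0 < g' (0 + h)"
    using DERIV_pos_inc_right[OF g'] by auto
  have "g' 0 = 0"
    using DERIV_local_max[OF g[of 0] d] max d by auto
  define h where "h = min c d / 2"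
  have h: "h > 0" "h < c" "h < d" using c d by (auto simp: h_def)
  have "\<exists>z>0. z < h \<and> g h - g 0 = (h - 0) * g' z"
    by (rule MVT2) (use g h in auto)
  then obtain z where z: "z > 0" "z < h" "g h - g 0 = h * g' z" by auto
  have "g' z > 0" using c(2)[of z] z h \<open>g' 0 = 0\<close> by auto
  then have "g h > g 0" using z h mult_pos_pos[of h "g' z"] by linarith
  then show False using max[of h] h by auto
qed

lemma lap_nonpos_at_max:
  fixes f :: "real^'n \<Rightarrow> real"
  assumes \<Omega>: "open \<Omega>" "y \<in> \<Omega>" and f: "f differentiable_on \<Omega>" and f': "\<And>j. pd j f differentiable_on \<Omega>"
    and max: "\<And>x. x \<in> \<Omega> \<Longrightarrow> f x \<le> f y"
  shows "lap f y \<le> 0"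
  unfolding lap_def
proof (rule sum_nonpos)
  fix j :: 'n
  obtain r where r: "r > 0" "ball y r \<subseteq> \<Omega>" using \<Omega> open_contains_ball by blast
  have inb: "y + s *\<^sub>R axis j 1 \<in> \<Omega>" if "\<bar>s\<bar> < r" for s :: real
    using r that by (auto simp: subset_iff dist_norm norm_axis_1)
  show "pd j (pd j f) y \<le> 0"
  proof (rule second_derivative_nonpos_at_max[OF r(1), where g = "\<lambda>s. f (y + s *\<^sub>R axis j 1)"
        and g' = "\<lambda>s. pd j f (y + s *\<^sub>R axis j 1)"])
    show "((\<lambda>s. pd j f (y + s *\<^sub>R axis j 1)) has_real_derivative pd j (pd j f) y) (at 0)"
      using dd_line[of "pd j f" y 0 "axis j 1"] differentiable_on_openD[OF f' \<Omega>] by (simp add: pd_eq_dd)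
    fix s :: real assume s: "\<bar>s\<bar> < r"
    show "((\<lambda>s. f (y + s *\<^sub>R axis j 1)) has_real_derivative pd j f (y + s *\<^sub>R axis j 1)) (at s)"
      using dd_line[OF differentiable_on_openD[OF f \<Omega>(1) inb[OF s]]] by (simp add: pd_eq_dd)
    show "f (y + s *\<^sub>R axis j 1) \<le> f (y + 0 *\<^sub>R axis j 1)"
      using max[OF inb[OF s]] by simp
  qed
qed

text \<open>Subtracting a small multiple of the elapsed time makes the inequality strict. A positive
  maximum of the perturbed function cannot lie on the frontier or at time \<open>a\<close>;
  elsewhere the Laplacian is nonpositive, so the perturbed function strictly decreases in time and
  was larger just before.\<close>

theorem heat_equation_nonpos:
  fixes h :: "real \<Rightarrow> real^'n \<Rightarrow> real"
  assumes \<Omega>: "open \<Omega>" "bounded \<Omega>" and \<nu>: "\<nu> \<ge> 0"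
    and cont: "continuous_on (closure \<Omega> \<times> {a..b}) (\<lambda>(x, t). h t x)"
    and diff: "\<And>t. t \<in> {a<..b} \<Longrightarrow> h t differentiable_on \<Omega>"
      "\<And>t j. t \<in> {a<..b} \<Longrightarrow> pd j (h t) differentiable_on \<Omega>"
    and heat: "\<And>t x. t \<in> {a<..b} \<Longrightarrow> x \<in> \<Omega> \<Longrightarrow> ((\<lambda>s. h s x) has_real_derivative \<nu> * lap (h t) x) (at t)"
    and init: "\<And>x. x \<in> \<Omega> \<Longrightarrow> h a x \<le> 0"
    and bdry: "\<And>t x. t \<in> {a..b} \<Longrightarrow> x \<in> frontier \<Omega> \<Longrightarrow> h t x \<le> 0"
    and x: "x \<in> closure \<Omega>" and t: "t \<in> {a..b}"
  shows "h t x \<le> 0"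
proof (rule ccontr)
  assume "\<not> h t x \<le> 0"
  \<comment> \<open>Small enough for the perturbed function to stay positive at
    \<open>(x, t)\<close>; the summand 1 keeps the denominator positive when
    \<open>t = a\<close>.\<close>
  define \<epsilon> where "\<epsilon> = h t x / (2 * (t - a + 1))"
  have eps: "\<epsilon> > 0" using \<open>\<not> h t x \<le> 0\<close> t by (simp add: \<epsilon>_def)
  let ?v = "\<lambda>(y, s). h s y - \<epsilon> * (s - a)"
  have "\<epsilon> * (t - a + 1) = h t x / 2" using t by (simp add: \<epsilon>_def field_simps)
  then have v1: "?v (x, t) > 0"
    using \<open>\<not> h t x \<le> 0\<close> eps by (simp add: algebra_simps)
  have "continuous_on (closure \<Omega> \<times> {a..b}) ?v"
    using cont unfolding case_prod_beta by (intro continuous_intros) auto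
  moreover have "compact (closure \<Omega> \<times> {a..b})" using \<Omega> by (intro compact_Times) auto
  ultimately obtain z where z: "z \<in> closure \<Omega> \<times> {a..b}" "\<forall>y\<in>closure \<Omega> \<times> {a..b}. ?v y \<le> ?v z"
    using continuous_attains_sup[of "closure \<Omega> \<times> {a..b}" ?v] x t by blast
  obtain y s where ys: "z = (y, s)" by force
  have y: "y \<in> closure \<Omega>" and s: "s \<in> {a..b}" using z ys by auto
  have max: "h r w - \<epsilon> * (r - a) \<le> h s y - \<epsilon> * (s - a)" if "w \<in> closure \<Omega>" "r \<in> {a..b}" for w r
    using z(2) that unfolding ys by auto
  have "h s y - \<epsilon> * (s - a) > 0" using max[OF x t] v1 by simp
  moreover have "\<epsilon> * (s - a) \<ge> 0" using eps s by simp
  ultimately have pos: "h s y > 0" by linarith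
  then have "y \<notin> frontier \<Omega>" using bdry[OF s] by force
  then have y\<Omega>: "y \<in> \<Omega>" using y \<Omega> by (simp add: frontier_def interior_open)
  then have s0: "s \<in> {a<..b}" using pos init[of y] s by (cases "s = a") auto
  have "lap (h s) y \<le> 0"
    by (rule lap_nonpos_at_max[OF \<Omega>(1) y\<Omega> diff[OF s0]]) (use max[of _ s] s closure_subset in auto)
  then have "\<nu> * lap (h s) y - \<epsilon> < 0" using \<nu> eps by (smt (verit) mult_nonneg_nonpos)
  moreover have "((\<lambda>r. h r y - \<epsilon> * (r - a)) has_real_derivative \<nu> * lap (h s) y - \<epsilon>) (at s)"
    by (auto intro!: derivative_eq_intros heat[OF s0 y\<Omega>])
  \<comment> \<open>Only earlier times are compared, because the maximum may be attained at the
    final time \<open>b\<close>.\<close>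
  ultimately obtain d where d: "d > 0"
    "\<And>k. k > 0 \<Longrightarrow> k < d \<Longrightarrow> h s y - \<epsilon> * (s - a) < h (s - k) y - \<epsilon> * (s - k - a)"
    using DERIV_neg_dec_left[of "\<lambda>r. h r y - \<epsilon> * (r - a)"] by blast
  define k where "k = min (d/2) (s - a)"
  have k: "k > 0" "k < d" "s - k \<in> {a..b}" using d s0 by (auto simp: k_def)
  show False using d(2)[OF k(1,2)] max[OF y k(3)] by simp
qed

text \<open>The one-sided bound for \<open>h\<close> and for its negative. The work lies in moving
  the sign through \<open>pd\<close> and \<open>lap\<close>, which is done only at points of
  \<Omega>, where differentiability is known.\<close>

corollary heat_equation_zero:
  fixes h :: "real \<Rightarrow> real^'n \<Rightarrow> real"
  assumes \<Omega>: "open \<Omega>" "bounded \<Omega>" and \<nu>: "\<nu> \<ge> 0"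
    and cont: "continuous_on (closure \<Omega> \<times> {a..b}) (\<lambda>(x, t). h t x)"
    and diff: "\<And>t. t \<in> {a<..b} \<Longrightarrow> h t differentiable_on \<Omega>"
      "\<And>t j. t \<in> {a<..b} \<Longrightarrow> pd j (h t) differentiable_on \<Omega>"
    and heat: "\<And>t x. t \<in> {a<..b} \<Longrightarrow> x \<in> \<Omega> \<Longrightarrow> ((\<lambda>s. h s x) has_real_derivative \<nu> * lap (h t) x) (at t)"
    and init: "\<And>x. x \<in> \<Omega> \<Longrightarrow> h a x = 0"
    and bdry: "\<And>t x. t \<in> {a..b} \<Longrightarrow> x \<in> frontier \<Omega> \<Longrightarrow> h t x = 0"
    and x: "x \<in> closure \<Omega>" and t: "t \<in> {a..b}"
  shows "h t x = 0"
proof -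
  have d: "h s differentiable (at y)" "pd j (h s) differentiable (at y)" if "s \<in> {a<..b}" "y \<in> \<Omega>" for s y j
    using diff[OF that(1)] that(2) \<Omega>(1) by (auto intro: differentiable_on_openD)
  have neg: "pd j (\<lambda>y. - f y) y = - pd j f y" if "f differentiable (at y)" for f :: "real^'n \<Rightarrow> real" and j y
    using pd_diff[OF differentiable_const that, of j 0] by simp
  have pdneg: "- pd j (h s) y = pd j (\<lambda>y. - h s y) y" if "s \<in> {a<..b}" "y \<in> \<Omega>" for s y j
    using neg[OF d(1)[OF that]] by simp
  have lapneg: "lap (\<lambda>y. - h s y) y = - lap (h s) y" if "s \<in> {a<..b}" "y \<in> \<Omega>" for s y
  proof -
    have "pd j (pd j (\<lambda>y. - h s y)) y = pd j (\<lambda>y. - pd j (h s) y) y" for j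
      by (rule pd_cong[OF \<Omega>(1) that(2)]) (use pdneg[OF that(1)] d(2)[OF that] in \<open>auto intro: differentiable_minus\<close>)
    then show ?thesis using neg[OF d(2)[OF that]] by (simp add: lap_def sum_negf)
  qed
  have "h t x \<le> 0"
    by (rule heat_equation_nonpos[OF \<Omega> \<nu> cont diff heat _ _ x t]) (auto simp: init bdry)
  moreover have "- h t x \<le> 0"
  proof (rule heat_equation_nonpos[OF \<Omega> \<nu> _ _ _ _ _ _ x t, where h = "\<lambda>t x. - h t x"])
    show "continuous_on (closure \<Omega> \<times> {a..b}) (\<lambda>(x, t). - h t x)"
      using continuous_on_minus[OF cont] by (simp add: case_prod_beta)
    fix s assume s: "s \<in> {a<..b}"
    show "(\<lambda>x. - h s x) differentiable_on \<Omega>"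
      using diff(1)[OF s] by (rule differentiable_on_minus)
    have "pd j (\<lambda>x. - h s x) differentiable (at y)" if "y \<in> \<Omega>" for y j
      by (rule differentiable_at_cong[OF \<Omega>(1) that pdneg[OF s] differentiable_minus[OF d(2)[OF s that]]])
    then show "pd j (\<lambda>x. - h s x) differentiable_on \<Omega>" for j
      by (simp add: differentiable_on_eq_differentiable_at[OF \<Omega>(1)])
    fix y assume y: "y \<in> \<Omega>"
    show "((\<lambda>s. - h s y) has_real_derivative \<nu> * lap (\<lambda>x. - h s x) y) (at s)"
      using DERIV_minus[OF heat[OF s y]] by (simp add: lapneg[OF s y])
  qed (auto simp: init bdry)
  ultimately show ?thesis by simp
qed

section \<open>Fields on space-time\<close>

text \<open>Derivatives of functions of the pair (x, t). Joint smoothness then provides every mixed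
  derivative, its continuity, and the exchange of time and space derivatives.\<close>

abbreviation dx :: "'n::finite \<Rightarrow> ((real^'n) \<times> real \<Rightarrow> real) \<Rightarrow> (real^'n) \<times> real \<Rightarrow> real" where
  "dx j \<equiv> dd (axis j 1, 0)"

abbreviation dt :: "((real^'n::finite) \<times> real \<Rightarrow> real) \<Rightarrow> (real^'n) \<times> real \<Rightarrow> real" where
  "dt \<equiv> dd (0, 1)"

lemma space_time_Basis: "(axis j 1, 0) \<in> (Basis :: ((real^'n) \<times> real) set)" "(0, 1) \<in> (Basis :: ((real^'n) \<times> real) set)"
  by (auto simp: Basis_prod_def Basis_axis)

lemma slice_space:
  fixes f :: "(real^'n) \<times> real \<Rightarrow> real"
  assumes "f differentiable (at (x, t))"
  shows "(\<lambda>y. f (y, t)) differentiable (at x)" "pd j (\<lambda>y. f (y, t)) x = dx j f (x, t)"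
proof -
  have "((\<lambda>y. (y, t)) has_derivative (\<lambda>h. (h, 0))) (at x)"
    by (auto intro!: derivative_eq_intros)
  from diff_chain_at[OF this, of f "frechet_derivative f (at (x, t))"]
  have D: "((\<lambda>y. f (y, t)) has_derivative (\<lambda>h. frechet_derivative f (at (x, t)) (h, 0))) (at x)"
    using assms by (simp add: frechet_derivative_works o_def)
  then show "(\<lambda>y. f (y, t)) differentiable (at x)" by (auto simp: differentiable_def)
  show "pd j (\<lambda>y. f (y, t)) x = dx j f (x, t)"
    using dd_eq[OF D] by (simp add: pd_eq_dd) (simp add: dd_def)
qed

lemma slice_time:
  fixes f :: "(real^'n) \<times> real \<Rightarrow> real"
  assumes "f differentiable (at (x, t))"
  shows "((\<lambda>s. f (x, s)) has_real_derivative dt f (x, t)) (at t)"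
  using dd_line[of f "(x, 0)" t "(0, 1)"] assms by simp

text \<open>Dictionary between the operators of the system, which act on a field at a fixed time,
  and joint derivatives on space-time. Second derivatives rely on \<open>U\<close> being open, since
  the first identity holds only there.\<close>

lemma smooth_slice:
  fixes f :: "(real^'n) \<times> real \<Rightarrow> real"
  assumes U: "open U" and I: "open I" and f: "smooth_on (U \<times> I) f" and t: "t \<in> I"
  shows "C1 U (\<lambda>y. f (y, t))" and "C1 U (pd j (\<lambda>y. f (y, t)))"
    and "x \<in> U \<Longrightarrow> pd j (\<lambda>y. f (y, t)) x = dx j f (x, t)"
    and "x \<in> U \<Longrightarrow> pd k (pd j (\<lambda>y. f (y, t))) x = dx k (dx j f) (x, t)"
    and "x \<in> U \<Longrightarrow> lap (\<lambda>y. f (y, t)) x = (\<Sum>j\<in>UNIV. dx j (dx j f) (x, t))"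
proof -
  have d: "g differentiable (at (y, t))" if "smooth_on (U \<times> I) g" "y \<in> U" for g :: "(real^'n) \<times> real \<Rightarrow> real" and y
    using smooth_on_differentiable[OF that(1)] open_Times[OF U I] that t
    by (auto intro: differentiable_on_openD)
  have pd: "pd j (\<lambda>y. g (y, t)) y = dx j g (y, t)" if "smooth_on (U \<times> I) g" "y \<in> U"
    for g :: "(real^'n) \<times> real \<Rightarrow> real" and y j
    using slice_space[OF d[OF that]] by simp
  have sm: "smooth_on (U \<times> I) (dx j g)" if "smooth_on (U \<times> I) g" for g :: "(real^'n) \<times> real \<Rightarrow> real" and j
    using smooth_on_dd[OF that] space_time_Basis by blast
  have C1: "C1 U (\<lambda>y. g (y, t))" if g: "smooth_on (U \<times> I) g" for g :: "(real^'n) \<times> real \<Rightarrow> real"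
    unfolding C1_def
  proof (intro conjI allI)
    show "(\<lambda>y. g (y, t)) differentiable_on U"
      unfolding differentiable_on_eq_differentiable_at[OF U] using slice_space(1)[OF d[OF g]] by blast
    fix j
    have "continuous_on U (\<lambda>y. dx j g (y, t))"
      using t by (intro continuous_on_compose2[OF smooth_on_continuous[OF sm[OF g]]] continuous_intros) auto
    then show "continuous_on U (pd j (\<lambda>y. g (y, t)))"
      using pd[OF g] by (subst continuous_on_cong[OF refl, of U _ "\<lambda>y. dx j g (y, t)"]) auto
  qed
  show "C1 U (\<lambda>y. f (y, t))" using C1[OF f] .
  have C1': "C1 U (pd j (\<lambda>y. f (y, t)))" for j
    by (rule C1_cong[OF U _ C1[OF sm[OF f]]]) (simp add: pd[OF f])
  then show "C1 U (pd j (\<lambda>y. f (y, t)))" .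
  show "x \<in> U \<Longrightarrow> pd j (\<lambda>y. f (y, t)) x = dx j f (x, t)" by (rule pd[OF f])
  have pd2: "pd k (pd j (\<lambda>y. f (y, t))) x = dx k (dx j f) (x, t)" if "x \<in> U" for x j k
  proof -
    have "pd k (pd j (\<lambda>y. f (y, t))) x = pd k (\<lambda>y. dx j f (y, t)) x"
      by (rule pd_cong[OF U that]) (use pd[OF f] slice_space(1)[OF d[OF sm[OF f] that]] in auto)
    then show ?thesis using pd[OF sm[OF f] that] by simp
  qed
  then show "x \<in> U \<Longrightarrow> pd k (pd j (\<lambda>y. f (y, t))) x = dx k (dx j f) (x, t)" .
  show "x \<in> U \<Longrightarrow> lap (\<lambda>y. f (y, t)) x = (\<Sum>j\<in>UNIV. dx j (dx j f) (x, t))"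
    by (simp add: lap_def pd2)
qed

lemma smooth_on_component:
  fixes v :: "real \<Rightarrow> real^'n \<Rightarrow> real^'n"
  assumes "open S" "smooth_on S (\<lambda>(x, t). v t x)"
  shows "smooth_on S (\<lambda>z. v (snd z) (fst z) $ i)"
  unfolding smooth_on_def
proof
  fix k
  have "Ck_on k S (\<lambda>z. v (snd z) (fst z))"
    using assms(2) unfolding smooth_on_def case_prod_beta' by blast
  then show "Ck_on k S (\<lambda>z. v (snd z) (fst z) $ i)"
    by (rule Ck_on_bounded_linear[OF bounded_linear_vec_nth assms(1)])
qed

section \<open>Solutions of the GePUP-E system\<close>

locale gepup =
  fixes \<Omega> :: "(real^'n) set" and \<rho> :: "real^'n \<Rightarrow> real"
    and \<nu> lam t0 T :: real
    and g w u :: "real \<Rightarrow> real^'n \<Rightarrow> real^'n"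
    and q \<phi> :: "real \<Rightarrow> real^'n \<Rightarrow> real"
    and U :: "(real^'n) set" and I :: "real set"
  assumes dom: "smooth_domain \<Omega>" and rho: "defining_fun \<Omega> \<rho>"
    and nu: "\<nu> > 0" and tT: "t0 < T"
    and U: "open U" "closure \<Omega> \<subseteq> U" and I: "open I" "{t0..T} \<subseteq> I"
    and smooth_w: "smooth_on (U \<times> I) (\<lambda>(x, t). w t x)"
    and smooth_u: "smooth_on (U \<times> I) (\<lambda>(x, t). u t x)"
    and smooth_q: "smooth_on (U \<times> I) (\<lambda>(x, t). q t x)"
    and smooth_phi: "smooth_on (U \<times> I) (\<lambda>(x, t). \<phi> t x)"
    and conservative: "\<forall>t\<in>I. \<forall>x\<in>U. g t x = - grad (\<phi> t) x"
    and sol: "GePUP_E \<Omega> \<rho> \<nu> lam t0 T g w u q"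
begin

section \<open>Joint space-time form of the fields\<close>

text \<open>Components as functions of (x, t), whereas the fields take time first. Note the letters:
  \<open>W\<close> belongs to \<open>w\<close>, \<open>V\<close> to \<open>u\<close>,
  \<open>Q\<close> to the pressure \<open>q\<close>, and \<open>P\<close> to the force potential
  \<phi>.\<close>

definition W where "W i z = w (snd z) (fst z) $ i"
definition V where "V i z = u (snd z) (fst z) $ i"
definition Q where "Q z = q (snd z) (fst z)"
definition P where "P z = \<phi> (snd z) (fst z)"

lemma open_\<Omega>: "open \<Omega>" and bounded_\<Omega>: "bounded \<Omega>"
  using dom by (auto simp: smooth_domain_def)

lemma frontier_closure: "x \<in> frontier \<Omega> \<Longrightarrow> x \<in> closure \<Omega>"
  by (simp add: frontier_def)

lemma in_U: "x \<in> closure \<Omega> \<Longrightarrow> x \<in> U" "x \<in> \<Omega> \<Longrightarrow> x \<in> U" "x \<in> frontier \<Omega> \<Longrightarrow> x \<in> U"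
  using U closure_subset frontier_closure by blast+

lemma in_I: "t \<in> {t0<..<T} \<Longrightarrow> t \<in> I" "t \<in> {t0..T} \<Longrightarrow> t \<in> I"
  using I by auto

lemma smooth: "smooth_on (U \<times> I) (W i)" "smooth_on (U \<times> I) (V i)" "smooth_on (U \<times> I) Q" "smooth_on (U \<times> I) P"
  using smooth_on_component[OF open_Times[OF U(1) I(1)] smooth_w, of i]
    smooth_on_component[OF open_Times[OF U(1) I(1)] smooth_u, of i] smooth_q smooth_phi
  unfolding W_def[abs_def] V_def[abs_def] Q_def[abs_def] P_def[abs_def] case_prod_beta' .

lemma smooth_deriv:
  "smooth_on (U \<times> I) f \<Longrightarrow> smooth_on (U \<times> I) (dx j f)"
  "smooth_on (U \<times> I) f \<Longrightarrow> smooth_on (U \<times> I) (dt f)"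
  using smooth_on_dd space_time_Basis by blast+

lemma comp: "w t x $ i = W i (x, t)" "u t x $ i = V i (x, t)" "q t = (\<lambda>x. Q (x, t))" "\<phi> t = (\<lambda>x. P (x, t))"
  by (simp_all add: W_def V_def Q_def P_def)

lemma cont_space:
  assumes f: "smooth_on (U \<times> I) f" and t: "t \<in> I" and A: "A \<subseteq> U"
  shows "continuous_on A (\<lambda>x. f (x, t))"
  using t A by (intro continuous_on_compose2[OF smooth_on_continuous[OF f]] continuous_intros) auto

lemma cont_time:
  assumes f: "smooth_on (U \<times> I) f" and x: "x \<in> U" and A: "A \<subseteq> I"
  shows "continuous_on A (\<lambda>t. f (x, t))"
  using x A by (intro continuous_on_compose2[OF smooth_on_continuous[OF f]] continuous_intros) auto

lemma diff_at:
  assumes "smooth_on (U \<times> I) f" "x \<in> U" "t \<in> I"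
  shows "f differentiable (at (x, t))"
  using smooth_on_differentiable[OF assms(1)] open_Times[OF U(1) I(1)] assms
  by (auto intro: differentiable_on_openD)

lemmas slice = smooth_slice[OF U(1) I(1)]
lemmas time_derivative = slice_time[OF diff_at]

lemma dx_commute:
  assumes "smooth_on (U \<times> I) f" "x \<in> U" "t \<in> I"
  shows "dx i (dx j f) (x, t) = dx j (dx i f) (x, t)" "dt (dx j f) (x, t) = dx j (dt f) (x, t)"
  by (rule smooth_on_dd_commute[OF open_Times[OF U(1) I(1)]]; simp add: assms space_time_Basis)+

lemma field_eqs:
  assumes "x \<in> U" "t \<in> I"
  shows "divg (w t) x = (\<Sum>i\<in>UNIV. dx i (W i) (x, t))"
    "divg (u t) x = (\<Sum>i\<in>UNIV. dx i (V i) (x, t))"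
    "vlap (w t) x $ i = (\<Sum>j\<in>UNIV. dx j (dx j (W i)) (x, t))"
    "conv (u t) (u t) x $ i = (\<Sum>j\<in>UNIV. V j (x, t) * dx j (V i) (x, t))"
    "grad (q t) x $ i = dx i Q (x, t)"
    "g t x $ i = - dx i P (x, t)"
  using conservative assms
  by (simp_all add: divg_def vlap_def conv_def grad_def comp(1,2) comp(3,4)
      slice(3,5)[OF smooth(1)] slice(3)[OF smooth(2)] slice(3)[OF smooth(3)] slice(3)[OF smooth(4)])

section \<open>Continuity up to the boundary and down to the initial time\<close>

text \<open>Both sides are continuous up to the boundary and agree in \<Omega>, hence on the
  closure. The values on the frontier are what the normal component needs.\<close>

lemma momentum:
  assumes t: "t \<in> {t0<..<T}" and x: "x \<in> closure \<Omega>"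
  shows "dt (W i) (x, t) = (g t x - conv (u t) (u t) x - grad (q t) x + \<nu> *\<^sub>R vlap (w t) x) $ i"
proof -
  \<comment> \<open>The residual in joint derivatives only, so that its continuity on the closure
    can be read off term by term.\<close>
  define R where "R y = dt (W i) (y, t) - (- dx i P (y, t) - (\<Sum>j\<in>UNIV. V j (y, t) * dx j (V i) (y, t))
      - dx i Q (y, t) + \<nu> * (\<Sum>j\<in>UNIV. dx j (dx j (W i)) (y, t)))" for y
  have R_eq: "R y = dt (W i) (y, t) - (g t y - conv (u t) (u t) y - grad (q t) y + \<nu> *\<^sub>R vlap (w t) y) $ i"
    if "y \<in> U" for y
    using that in_I(1)[OF t] by (simp add: R_def field_eqs)
  have "R x = 0"
  proof (rule continuous_constant_on_closure[OF _ _ x])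
    show "continuous_on (closure \<Omega>) R"
      unfolding R_def[abs_def] using in_I(1)[OF t] U(2)
      by (intro continuous_on_add continuous_on_diff continuous_on_minus continuous_on_mult continuous_on_sum
          continuous_on_const cont_space smooth_deriv smooth) auto
    fix y assume y: "y \<in> \<Omega>"
    have "((\<lambda>s. w s y) has_vector_derivative
        (g t y - conv (u t) (u t) y - grad (q t) y + \<nu> *\<^sub>R vlap (w t) y)) (at t)"
      using sol t y unfolding GePUP_E_def by blast
    then have "((\<lambda>s. w s y $ i) has_real_derivative
        (g t y - conv (u t) (u t) y - grad (q t) y + \<nu> *\<^sub>R vlap (w t) y) $ i) (at t)"
      unfolding has_real_derivative_iff_has_vector_derivative
      by (rule bounded_linear.has_vector_derivative[OF bounded_linear_vec_nth])
    moreover have "((\<lambda>s. w s y $ i) has_real_derivative dt (W i) (y, t)) (at t)"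
      unfolding comp by (rule time_derivative[OF smooth(1) in_U(2)[OF y] in_I(1)[OF t]])
    ultimately show "R y = 0"
      using DERIV_unique R_eq[OF in_U(2)[OF y]] by fastforce
  qed
  then show ?thesis using R_eq[OF in_U(1)[OF x]] by simp
qed

text \<open>Transports to \<open>t0\<close> those constraints that the system imposes only on the
  open time interval.\<close>

lemma vanishes_initially:
  fixes f :: "real \<Rightarrow> real"
  assumes "continuous_on {t0..T} f" "\<And>t. t \<in> {t0<..<T} \<Longrightarrow> f t = 0"
  shows "f t0 = 0"
  using continuous_constant_on_closure[of "{t0<..<T}" f 0 t0] assms tT
  by (simp add: closure_greaterThanLessThan)

lemma projection:
  assumes t: "t \<in> {t0<..<T}"
  obtains V' \<psi> where "open V'" "closure \<Omega> \<subseteq> V'" "Ck_on 2 V' \<psi>"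
    "\<And>x. x \<in> \<Omega> \<Longrightarrow> lap \<psi> x = divg (w t) x"
    "\<And>x. x \<in> frontier \<Omega> \<Longrightarrow> normal \<rho> x \<bullet> grad \<psi> x = normal \<rho> x \<bullet> w t x"
    "\<And>x. x \<in> closure \<Omega> \<Longrightarrow> u t x = w t x - grad \<psi> x"
proof -
  have "leray \<Omega> \<rho> (w t) (u t)" using sol t unfolding GePUP_E_def by blast
  then show ?thesis unfolding leray_def using that by blast
qed

lemma differentiable_slice:
  fixes f :: "(real^'n) \<times> real \<Rightarrow> real"
  shows "smooth_on (U \<times> I) f \<Longrightarrow> x \<in> U \<Longrightarrow> t \<in> I \<Longrightarrow> (\<lambda>y. f (y, t)) differentiable (at x)"
  by (rule slice_space(1)[OF diff_at])

text \<open>Take the divergence of \<open>u = w - grad \<psi>\<close>: the Poisson equation for the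
  potential cancels the divergence of \<open>w\<close>.\<close>

lemma divg_u_0:
  assumes t: "t \<in> {t0<..<T}" and x: "x \<in> \<Omega>"
  shows "divg (u t) x = 0"
proof -
  obtain V' \<psi> where \<psi>: "open V'" "closure \<Omega> \<subseteq> V'" "Ck_on 2 V' \<psi>"
    "\<And>x. x \<in> \<Omega> \<Longrightarrow> lap \<psi> x = divg (w t) x"
    "\<And>x. x \<in> frontier \<Omega> \<Longrightarrow> normal \<rho> x \<bullet> grad \<psi> x = normal \<rho> x \<bullet> w t x"
    "\<And>x. x \<in> closure \<Omega> \<Longrightarrow> u t x = w t x - grad \<psi> x"
    by (rule projection[OF t], rule that)
  have "pd i (\<lambda>y. u t y $ i) x = pd i (\<lambda>y. w t y $ i) x - pd i (pd i \<psi>) x" for i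
  proof -
    have "x \<in> V'" using x \<psi>(2) closure_subset by blast
    then have d\<psi>: "pd i \<psi> differentiable (at x)"
      using Ck_on_2_C1[OF \<psi>(3)] \<psi>(1) by (auto simp: C1_def intro: differentiable_on_openD)
    have dw: "(\<lambda>y. w t y $ i) differentiable (at x)"
      unfolding comp by (rule differentiable_slice[OF smooth(1) in_U(2)[OF x] in_I(1)[OF t]])
    have "pd i (\<lambda>y. u t y $ i) x = pd i (\<lambda>y. w t y $ i - pd i \<psi> y) x"
    proof (rule pd_cong[OF open_\<Omega> x])
      show "w t y $ i - pd i \<psi> y = u t y $ i" if "y \<in> \<Omega>" for y
        using \<psi>(6)[OF subsetD[OF closure_subset that]] by (simp add: grad_def)
    qed (intro differentiable_diff dw d\<psi>)
    then show ?thesis using pd_diff[OF dw d\<psi>] by simp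
  qed
  then have "divg (u t) x = divg (w t) x - lap \<psi> x"
    by (simp add: divg_def lap_def sum_subtractf)
  then show ?thesis using \<psi>(4)[OF x] by simp
qed

lemma initial: "x \<in> closure \<Omega> \<Longrightarrow> w t0 x = u t0 x"
  using sol unfolding GePUP_E_def by blast

section \<open>The divergence of w\<close>

text \<open>The divergence of \<open>w\<close> at points of \<open>U\<close> and times in
  \<open>I\<close>, in joint derivatives so that it can also be differentiated in time.\<close>

definition H where "H t x = (\<Sum>i\<in>UNIV. dx i (W i) (x, t))"

lemma C1_H: assumes t: "t \<in> I" shows "C1 U (H t)" "C1 U (pd j (H t))"
  and "x \<in> U \<Longrightarrow> pd k (pd j (H t)) x = (\<Sum>i\<in>UNIV. dx k (dx j (dx i (W i))) (x, t))"
proof -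
  have eq: "H t = (\<lambda>x. \<Sum>i\<in>UNIV. dx i (W i) (x, t))" by (simp add: H_def fun_eq_iff)
  have pdH: "(\<Sum>i\<in>UNIV. dx j (dx i (W i)) (y, t)) = pd j (H t) y" if y: "y \<in> U" for y j
    unfolding eq using y t
    by (subst pd_sum) (auto simp: slice(3)[OF smooth_deriv(1)[OF smooth(1)]]
        intro: differentiable_slice smooth_deriv smooth)
  have C1s: "C1 U (\<lambda>x. \<Sum>i\<in>UNIV. dx j (dx i (W i)) (x, t))" for j
    by (intro C1_sum[OF U(1)] slice(1) smooth_deriv smooth t) auto
  show "C1 U (H t)"
    unfolding eq by (intro C1_sum[OF U(1)] slice(1) smooth_deriv smooth t) auto
  show "C1 U (pd j (H t))"
    by (rule C1_cong[OF U(1) pdH C1s])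
  assume x: "x \<in> U"
  have "pd k (pd j (H t)) x = pd k (\<lambda>x. \<Sum>i\<in>UNIV. dx j (dx i (W i)) (x, t)) x"
    by (rule pd_cong[OF U(1) x pdH]) (use C1s[of j] U(1) x in \<open>auto simp: C1_def intro: differentiable_on_openD\<close>)
  also have "\<dots> = (\<Sum>i\<in>UNIV. dx k (dx j (dx i (W i))) (x, t))"
    using x t by (subst pd_sum) (auto simp: slice(3)[OF smooth_deriv(1)[OF smooth_deriv(1)[OF smooth(1)]]]
        intro: differentiable_slice smooth_deriv smooth)
  finally show "pd k (pd j (H t)) x = (\<Sum>i\<in>UNIV. dx k (dx j (dx i (W i))) (x, t))" .
qed

text \<open>Divergence of the momentum equation: by the pressure equation the terms from
  \<open>B\<close> and \<open>Q\<close> cancel in the sum over \<open>i\<close>. Symmetry of mixed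
  derivatives moves the divergence past the time derivative and the Laplacian.\<close>

lemma divergence_heat_equation:
  assumes t: "t \<in> {t0<..<T}" and x: "x \<in> \<Omega>"
  shows "((\<lambda>s. H s x) has_real_derivative \<nu> * lap (H t) x) (at t)"
proof -
  note xU = in_U(2)[OF x] and tI = in_I(1)[OF t]
  define B where "B i y = - dx i P (y, t) - (\<Sum>j\<in>UNIV. V j (y, t) * dx j (V i) (y, t))" for i y
  have B: "B i y = (g t y - conv (u t) (u t) y) $ i" if "y \<in> U" for i y
    using that tI by (simp add: B_def field_eqs)
  have dB: "B i differentiable (at x)" for i
    unfolding B_def[abs_def]
    by (intro differentiable_diff differentiable_minus differentiable_sum differentiable_mult ballI finite
        differentiable_slice smooth_deriv smooth xU tI)
  define L where "L i y = (\<Sum>j\<in>UNIV. dx j (dx j (W i)) (y, t))" for i y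
  have dL: "L i differentiable (at x)" for i
    unfolding L_def[abs_def]
    by (intro differentiable_sum ballI finite differentiable_slice smooth_deriv smooth xU tI)
  have pdL: "pd i (L i) x = (\<Sum>j\<in>UNIV. dx j (dx j (dx i (W i))) (x, t))" for i
  proof -
    have "pd i (L i) x = (\<Sum>j\<in>UNIV. dx i (dx j (dx j (W i))) (x, t))"
      unfolding L_def[abs_def] using xU tI
      by (subst pd_sum) (auto simp: slice(3)[OF smooth_deriv(1)[OF smooth_deriv(1)[OF smooth(1)]]]
          intro: differentiable_slice smooth_deriv smooth)
    moreover have "dx i (dx j (dx j (W i))) (x, t) = dx j (dx j (dx i (W i))) (x, t)" for j
    proof -
      have "dx i (dx j (dx j (W i))) (x, t) = dx j (dx i (dx j (W i))) (x, t)"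
        by (rule dx_commute(1)[OF smooth_deriv(1)[OF smooth(1)] xU tI])
      also have "\<dots> = dx j (dx j (dx i (W i))) (x, t)"
      proof (rule dd_cong[OF open_Times[OF U(1) I(1)]])
        show "dx j (dx i (W i)) z = dx i (dx j (W i)) z" if "z \<in> U \<times> I" for z
          using dx_commute(1)[OF smooth(1)] that by (cases z) auto
      qed (use xU tI in \<open>auto intro!: diff_at smooth_deriv smooth\<close>)
      finally show ?thesis .
    qed
    ultimately show ?thesis by simp
  qed
  have split: "dx i (dt (W i)) (x, t) = pd i (B i) x - pd i (pd i (\<lambda>y. Q (y, t))) x + \<nu> * pd i (L i) x" for i
  proof -
    have dQ: "pd i (\<lambda>y. Q (y, t)) differentiable (at x)"
      using slice(2)[OF smooth(3) tI] U(1) xU by (auto simp: C1_def intro: differentiable_on_openD)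
    have dnL: "(\<lambda>y. - \<nu> * L i y) differentiable (at x)" by (intro differentiable_mult dL) auto
    have dBQ: "(\<lambda>y. B i y - pd i (\<lambda>y. Q (y, t)) y) differentiable (at x)"
      by (intro differentiable_diff dB dQ)
    have "dx i (dt (W i)) (x, t) = pd i (\<lambda>y. dt (W i) (y, t)) x"
      using slice(3)[OF smooth_deriv(2)[OF smooth(1)] tI xU] by simp
    \<comment> \<open>The viscous term is written as subtraction of its negative, so that the
      difference rule alone splits the expression.\<close>
    also have "\<dots> = pd i (\<lambda>y. B i y - pd i (\<lambda>y. Q (y, t)) y - (- \<nu> * L i y)) x"
    proof (rule pd_cong[OF open_\<Omega> x])
      fix y assume y: "y \<in> \<Omega>"
      then have "y \<in> closure \<Omega>" using closure_subset by blast
      from momentum[OF t this] show "B i y - pd i (\<lambda>y. Q (y, t)) y - (- \<nu> * L i y) = dt (W i) (y, t)"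
        using in_U(2)[OF y] tI by (simp add: B field_eqs L_def slice(3)[OF smooth(3)])
    qed (intro differentiable_diff dBQ dnL)
    also have "\<dots> = pd i (B i) x - pd i (pd i (\<lambda>y. Q (y, t))) x - pd i (\<lambda>y. - \<nu> * L i y) x"
      by (simp only: pd_diff[OF dBQ dnL] pd_diff[OF dB dQ])
    also have "pd i (\<lambda>y. - \<nu> * L i y) x = - \<nu> * pd i (L i) x"
      using pd_mult[of "\<lambda>_. - \<nu>" x "L i" i] dL pd_const[of i "- \<nu>" x] by simp
    finally show ?thesis by simp
  qed
  have "lap (q t) x = divg (\<lambda>y. g t y - conv (u t) (u t) y) x"
    using sol t x unfolding GePUP_E_def by blast
  also have "\<dots> = (\<Sum>i\<in>UNIV. pd i (B i) x)"
    unfolding divg_def by (intro sum.cong refl pd_cong[OF U(1) xU B dB])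
  finally have lapq: "(\<Sum>i\<in>UNIV. pd i (B i) x) = (\<Sum>i\<in>UNIV. pd i (pd i (\<lambda>y. Q (y, t))) x)"
    by (simp add: lap_def comp(3))
  have "((\<lambda>s. H s x) has_real_derivative (\<Sum>i\<in>UNIV. dt (dx i (W i)) (x, t))) (at t)"
    unfolding H_def by (intro DERIV_sum time_derivative smooth_deriv smooth xU tI)
  also have "(\<Sum>i\<in>UNIV. dt (dx i (W i)) (x, t)) = (\<Sum>i\<in>UNIV. dx i (dt (W i)) (x, t))"
    using dx_commute(2)[OF smooth(1) xU tI] by simp
  also have "\<dots> = \<nu> * (\<Sum>i\<in>UNIV. pd i (L i) x)"
    by (simp add: split sum.distrib sum_subtractf sum_distrib_left lapq)
  also have "(\<Sum>i\<in>UNIV. pd i (L i) x) = lap (H t) x"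
    unfolding lap_def C1_H(3)[OF tI xU] pdL by (rule sum.swap)
  finally show ?thesis .
qed

text \<open>The initial value vanishes because \<open>w\<close> and \<open>u\<close> agree at
  \<open>t0\<close> on the open set \<Omega>, hence so do their spatial derivatives there, and the
  divergence of \<open>u\<close> at \<open>t0\<close> is a limit of zeros. The boundary value at
  \<open>t0\<close> is a limit as well.\<close>

lemma divg_w_0:
  assumes t: "t \<in> {t0<..<T}" and x: "x \<in> closure \<Omega>"
  shows "divg (w t) x = 0"
proof -
  have H: "H s y = divg (w s) y" if "y \<in> U" "s \<in> I" for s y
    using that by (simp add: H_def field_eqs)
  have cH: "continuous_on {t0..T} (\<lambda>s. H s y)" if "y \<in> U" for y
    unfolding H_def using I(2) that
    by (intro continuous_on_sum cont_time smooth_deriv smooth) auto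
  have H0: "H t0 y = 0" if y: "y \<in> \<Omega>" for y
  proof -
    have t0: "t0 \<in> I" using in_I(2)[of t0] tT by simp
    have "dx i (W i) (y, t0) = dx i (V i) (y, t0)" for i
    proof -
      have "pd i (\<lambda>z. W i (z, t0)) y = pd i (\<lambda>z. V i (z, t0)) y"
      proof (rule pd_cong[OF open_\<Omega> y])
        show "V i (z, t0) = W i (z, t0)" if "z \<in> \<Omega>" for z
          using initial[of z] that closure_subset[of \<Omega>] by (auto simp: W_def V_def)
      qed (intro differentiable_slice smooth in_U(2)[OF y] t0)
      then show ?thesis by (simp add: slice(3)[OF smooth(1) t0 in_U(2)[OF y]] slice(3)[OF smooth(2) t0 in_U(2)[OF y]])
    qed
    moreover have "(\<Sum>i\<in>UNIV. dx i (V i) (y, t0)) = 0"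
    proof (rule vanishes_initially)
      show "continuous_on {t0..T} (\<lambda>s. \<Sum>i\<in>UNIV. dx i (V i) (y, s))"
        using I(2) in_U(2)[OF y] by (intro continuous_on_sum cont_time smooth_deriv smooth) auto
      show "(\<Sum>i\<in>UNIV. dx i (V i) (y, s)) = 0" if "s \<in> {t0<..<T}" for s
        using divg_u_0[OF that y] field_eqs(2)[OF in_U(2)[OF y] in_I(1)[OF that]] by simp
    qed
    ultimately show ?thesis by (simp add: H_def)
  qed
  have bdry: "H s y = 0" if s: "s \<in> {t0..<T}" and y: "y \<in> frontier \<Omega>" for s y
  proof -
    have bc: "H r y = 0" if "r \<in> {t0<..<T}" for r
    proof -
      have "divg (w r) y = 0" using sol that y unfolding GePUP_E_def by blast
      then show ?thesis using H[OF in_U(3)[OF y] in_I(1)[OF that]] by simp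
    qed
    have "H t0 y = 0" by (rule vanishes_initially[OF cH[OF in_U(3)[OF y]] bc])
    then show ?thesis using bc[of s] s by (cases "s = t0") auto
  qed
  \<comment> \<open>The maximum principle runs on \<open>{t0..t}\<close> with \<open>t\<close> below
    \<open>T\<close>, so the equation is available up to and including the final time.\<close>
  have "H t x = 0"
  proof (rule heat_equation_zero[OF open_\<Omega> bounded_\<Omega>, where h = H and a = t0 and b = t and \<nu> = \<nu>])
    show "continuous_on (closure \<Omega> \<times> {t0..t}) (\<lambda>(x, t). H t x)"
    proof -
      have "closure \<Omega> \<times> {t0..t} \<subseteq> U \<times> I" using U(2) I(2) t by auto
      then have "continuous_on (closure \<Omega> \<times> {t0..t}) (dx i (W i))" for i
        using smooth_on_continuous[OF smooth_deriv(1)[OF smooth(1)]] continuous_on_subset by blast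
      then show ?thesis unfolding H_def case_prod_beta' by (intro continuous_on_sum) simp
    qed
    fix s assume "s \<in> {t0<..t}"
    then have s: "s \<in> {t0<..<T}" using t by auto
    have "\<Omega> \<subseteq> U" using U(2) closure_subset by blast
    then show "H s differentiable_on \<Omega>" "pd j (H s) differentiable_on \<Omega>" for j
      using C1_H(1,2)[OF in_I(1)[OF s]] by (auto simp: C1_def intro: differentiable_on_subset)
    show "((\<lambda>s. H s y) has_real_derivative \<nu> * lap (H s) y) (at s)" if "y \<in> \<Omega>" for y
      by (rule divergence_heat_equation[OF s that])
  qed (use nu H0 bdry t x in auto)
  then show ?thesis using H[OF in_U(1)[OF x] in_I(1)[OF t]] by simp
qed

section \<open>Boundary values of w and identification with u\<close>

text \<open>Taking the normal component of the momentum equation on the frontier and inserting the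
  Neumann condition for \<open>q\<close> cancels force, convection and viscosity. The initial value
  comes from \<open>w = u\<close> at \<open>t0\<close> and the condition on \<open>u\<close> at
  later times.\<close>

lemma normal_w_0:
  assumes t: "t \<in> {t0<..<T}" and x: "x \<in> frontier \<Omega>"
  shows "normal \<rho> x \<bullet> w t x = 0"
proof -
  note xU = in_U(3)[OF x]
  let ?n = "normal \<rho> x"
  define y where "y s = (\<Sum>i\<in>UNIV. ?n $ i * W i (x, s))" for s
  have y: "y s = ?n \<bullet> w s x" for s
    by (simp add: y_def inner_vec_def W_def)
  have cy: "continuous_on {t0..T} y"
    unfolding y_def using I(2) xU
    by (intro continuous_on_sum continuous_on_mult continuous_on_const cont_time smooth) auto
  have "y t0 = (\<Sum>i\<in>UNIV. ?n $ i * V i (x, t0))"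
    using initial[OF frontier_closure[OF x]] by (simp add: y_def W_def V_def)
  also have "\<dots> = 0"
  proof (rule vanishes_initially)
    show "continuous_on {t0..T} (\<lambda>s. \<Sum>i\<in>UNIV. ?n $ i * V i (x, s))"
      using I(2) xU by (intro continuous_on_sum continuous_on_mult continuous_on_const cont_time smooth) auto
    fix s assume "s \<in> {t0<..<T}"
    then have "u s x \<bullet> ?n = 0" using sol x unfolding GePUP_E_def by blast
    then show "(\<Sum>i\<in>UNIV. ?n $ i * V i (x, s)) = 0"
      by (simp add: inner_vec_def V_def mult.commute)
  qed
  finally have y0: "y t0 = 0" .
  have dy: "(y has_real_derivative - lam * y s) (at s)" if s: "s \<in> {t0<..<T}" for s
  proof -
    let ?G = "g s x - conv (u s) (u s) x" and ?L = "\<nu> *\<^sub>R vlap (w s) x"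
    have "?n \<bullet> grad (q s) x = ?n \<bullet> (?G + ?L) + lam * (?n \<bullet> w s x)"
      using sol s x unfolding GePUP_E_def by blast
    then have "?n \<bullet> (?G - grad (q s) x + ?L) = - lam * y s"
      by (simp add: y inner_add_right inner_diff_right)
    moreover have "?n \<bullet> (?G - grad (q s) x + ?L) = (\<Sum>i\<in>UNIV. ?n $ i * dt (W i) (x, s))"
      using momentum[OF s frontier_closure[OF x]] by (simp add: inner_vec_def)
    moreover have "(y has_real_derivative (\<Sum>i\<in>UNIV. ?n $ i * dt (W i) (x, s))) (at s)"
      unfolding y_def[abs_def] by (intro DERIV_sum DERIV_cmult time_derivative smooth xU in_I(1)[OF s])
    ultimately show ?thesis by simp
  qed
  \<comment> \<open>Integrating factor for the linear equation \<open>dy\<close>.\<close>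
  have "y t * exp (lam * t) = y t0 * exp (lam * t0)"
  proof (rule DERIV_isconst2[of t0 t "\<lambda>s. y s * exp (lam * s)"])
    show "continuous_on {t0..t} (\<lambda>s. y s * exp (lam * s))"
      using t by (intro continuous_intros continuous_on_subset[OF cy]) auto
    show "((\<lambda>s. y s * exp (lam * s)) has_real_derivative 0) (at s)" if "t0 < s" "s < t" for s
    proof -
      have "s \<in> {t0<..<T}" using that t by auto
      then show ?thesis by (auto intro!: derivative_eq_intros dy)
    qed
  qed (use t in auto)
  then show ?thesis using y0 y by simp
qed

lemma w_frontier_0:
  assumes t: "t \<in> {t0<..<T}" and x: "x \<in> frontier \<Omega>"
  shows "w t x = 0"
proof -
  have "\<forall>\<tau>. \<tau> \<bullet> normal \<rho> x = 0 \<longrightarrow> w t x \<bullet> \<tau> = 0"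
    using sol t x unfolding GePUP_E_def by blast
  \<comment> \<open>With no normal component, \<open>w t x\<close> is itself an admissible tangent
    vector \<tau>.\<close>
  then have "w t x \<bullet> w t x = 0"
    using normal_w_0[OF t x] by (simp add: inner_commute)
  then show ?thesis by simp
qed

text \<open>Integrating by parts with factor \<psi> and field \<open>grad \<psi>\<close> leaves only
  the integral of the squared gradient, as \<psi> is harmonic in \<Omega> and
  \<open>grad \<psi>\<close> is tangential on the frontier.\<close>

lemma u_eq_w:
  assumes t: "t \<in> {t0<..<T}" and x: "x \<in> \<Omega>"
  shows "u t x = w t x"
proof -
  obtain V' \<psi> where \<psi>: "open V'" "closure \<Omega> \<subseteq> V'" "Ck_on 2 V' \<psi>"
    "\<And>x. x \<in> \<Omega> \<Longrightarrow> lap \<psi> x = divg (w t) x"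
    "\<And>x. x \<in> frontier \<Omega> \<Longrightarrow> normal \<rho> x \<bullet> grad \<psi> x = normal \<rho> x \<bullet> w t x"
    "\<And>x. x \<in> closure \<Omega> \<Longrightarrow> u t x = w t x - grad \<psi> x"
    by (rule projection[OF t], rule that)
  note sub = subsetD[OF closure_subset[of \<Omega>]]
  have c: "continuous_on \<Omega> (\<lambda>x. grad \<psi> x \<bullet> grad \<psi> x)"
  proof -
    have "continuous_on \<Omega> (pd j \<psi>)" for j
      using Ck_on_2_C1(1)[OF \<psi>(3)] \<psi>(2) closure_subset[of \<Omega>] by (auto simp: C1_def intro: continuous_on_subset)
    then show ?thesis unfolding inner_vec_def grad_def by (intro continuous_intros) simp
  qed
  have "((\<lambda>x. grad \<psi> x \<bullet> grad \<psi> x + \<psi> x * divg (grad \<psi>) x) has_integral 0) \<Omega>"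
  proof (rule integral_scaled_tangential[OF rho bounded_\<Omega> \<psi>(1,2)])
    show "C1 V' \<psi>" "C1 V' (\<lambda>x. grad \<psi> x $ i)" for i
      using Ck_on_2_C1[OF \<psi>(3)] by (simp_all add: grad_def)
    fix y assume y: "y \<in> frontier \<Omega>"
    then have "grad \<rho> y \<noteq> 0"
      using rho defining_fun_frontier(2)[OF rho] by (simp add: defining_fun_def)
    moreover have "normal \<rho> y \<bullet> grad \<psi> y = 0" using \<psi>(5)[OF y] normal_w_0[OF t y] by simp
    ultimately show "\<psi> y * (grad \<rho> y \<bullet> grad \<psi> y) = 0" by (simp add: normal_def)
  qed
  moreover have "divg (grad \<psi>) y = 0" if "y \<in> \<Omega>" for y
    using \<psi>(4)[OF that] divg_w_0[OF t sub[OF that]] by (simp add: divg_def lap_def grad_def)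
  then have "((\<lambda>x. grad \<psi> x \<bullet> grad \<psi> x + \<psi> x * divg (grad \<psi>) x) has_integral 0) \<Omega>
      \<longleftrightarrow> ((\<lambda>x. grad \<psi> x \<bullet> grad \<psi> x) has_integral 0) \<Omega>"
    by (intro has_integral_cong) simp
  ultimately have "((\<lambda>x. grad \<psi> x \<bullet> grad \<psi> x) has_integral 0) \<Omega>" by simp
  then have "grad \<psi> x \<bullet> grad \<psi> x = 0"
    by (rule has_integral_0_imp_0_open[OF open_\<Omega> x c, rotated]) simp
  then show ?thesis using \<psi>(6)[OF sub[OF x]] by simp
qed

section \<open>The energy balance\<close>

text \<open>Since \<open>u\<close> and \<open>w\<close> agree in \<Omega> at all times near
  \<open>t\<close>, the energy may be differentiated under the integral through \<open>w\<close>,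
  the field whose time derivative is known.\<close>

lemma energy_derivative:
  assumes t: "t \<in> {t0<..<T}"
  shows "((\<lambda>s. (1/2) * integral \<Omega> (\<lambda>x. u s x \<bullet> u s x)) has_real_derivative
    integral \<Omega> (\<lambda>x. \<Sum>i\<in>UNIV. W i (x, t) * dt (W i) (x, t))) (at t)"
proof -
  \<comment> \<open>Half the distance to the nearer end point, so that the closed time interval
    stays inside and compactness bounds the integrand derivative \<open>F'\<close>.\<close>
  define d where "d = min (t - t0) (T - t) / 2"
  have d: "d > 0" "d < t - t0" "d < T - t" using t by (auto simp: d_def min_def)
  then have "{t - d..t + d} \<subseteq> {t0<..<T}" by auto
  note d = d(1) this
  define F where "F s x = (\<Sum>i\<in>UNIV. (W i (x, s))\<^sup>2)" for s x
  define F' where "F' s x = (\<Sum>i\<in>UNIV. 2 * (W i (x, s) * dt (W i) (x, s)))" for s x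
  have sub: "closure \<Omega> \<times> {t - d..t + d} \<subseteq> U \<times> I" using U(2) I(2) d(2) by force
  then have "continuous_on (closure \<Omega> \<times> {t - d..t + d}) f" if "smooth_on (U \<times> I) f" for f :: "(real^'n) \<times> real \<Rightarrow> real"
    using smooth_on_continuous[OF that] continuous_on_subset by blast
  then have "continuous_on (closure \<Omega> \<times> {t - d..t + d}) (\<lambda>z. \<Sum>i\<in>UNIV. 2 * (W i z * dt (W i) z))"
    by (intro continuous_on_sum continuous_on_mult continuous_on_const) (auto intro: smooth smooth_deriv)
  then have "bounded ((\<lambda>z. \<Sum>i\<in>UNIV. 2 * (W i z * dt (W i) z)) ` (closure \<Omega> \<times> {t - d..t + d}))"
    using bounded_\<Omega> by (intro compact_imp_bounded compact_continuous_image compact_Times) auto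
  then obtain M where M: "\<And>x s. x \<in> closure \<Omega> \<Longrightarrow> s \<in> {t - d..t + d} \<Longrightarrow> \<bar>F' s x\<bar> \<le> M"
    unfolding bounded_iff F'_def by fastforce
  have near: "s \<in> I" "s \<in> {t - d..t + d}" if "\<bar>s - t\<bar> < d" for s
  proof -
    show "s \<in> {t - d..t + d}" using that by auto
    then show "s \<in> I" using d(2) in_I(1) by blast
  qed
  have "((\<lambda>s. integral \<Omega> (F s)) has_real_derivative integral \<Omega> (F' t)) (at t)"
  proof (rule has_real_derivative_integral[OF d(1), where M = M])
    show "(\<lambda>_. M) integrable_on \<Omega>"
      by (intro integrable_on_continuous_closure open_\<Omega> bounded_\<Omega> continuous_on_const)
    fix s assume s: "\<bar>s - t\<bar> < d"
    show "F s integrable_on \<Omega>"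
      unfolding F_def
      by (intro integrable_on_continuous_closure open_\<Omega> bounded_\<Omega> continuous_on_sum continuous_on_power
          cont_space smooth near[OF s] U)
    fix x assume x: "x \<in> \<Omega>"
    show "((\<lambda>s. F s x) has_real_derivative F' s x) (at s)"
      unfolding F_def F'_def
    proof (rule DERIV_sum)
      show "((\<lambda>s. (W i (x, s))\<^sup>2) has_real_derivative 2 * (W i (x, s) * dt (W i) (x, s))) (at s)" for i
        using DERIV_power[OF time_derivative[OF smooth(1) in_U(2)[OF x] near(1)[OF s]], of i 2]
        by (simp add: mult_ac)
    qed
    show "\<bar>F' s x\<bar> \<le> M" using M near(2)[OF s] x closure_subset[of \<Omega>] by blast
  qed
  from DERIV_cmult[OF this, of "1/2"]
  have "((\<lambda>s. (1/2) * integral \<Omega> (F s)) has_real_derivative (1/2) * integral \<Omega> (F' t)) (at t)" .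
  then have "((\<lambda>s. (1/2) * integral \<Omega> (\<lambda>x. u s x \<bullet> u s x)) has_real_derivative (1/2) * integral \<Omega> (F' t)) (at t)"
  proof (rule has_field_derivative_transform_within_open[OF _ open_greaterThanLessThan t])
    fix s assume s: "s \<in> {t0<..<T}"
    have "integral \<Omega> (F s) = integral \<Omega> (\<lambda>x. u s x \<bullet> u s x)"
      by (rule integral_cong) (simp add: u_eq_w[OF s] F_def inner_vec_def W_def power2_eq_square)
    then show "(1/2) * integral \<Omega> (F s) = (1/2) * integral \<Omega> (\<lambda>x. u s x \<bullet> u s x)" by simp
  qed
  moreover have "(1/2) * integral \<Omega> (F' t) = integral \<Omega> (\<lambda>x. \<Sum>i\<in>UNIV. W i (x, t) * dt (W i) (x, t))"
    unfolding F'_def by (simp flip: sum_distrib_left)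
  ultimately show ?thesis by simp
qed

text \<open>The integrand is \<open>w\<close> times its time derivative. The momentum equation
  writes it as a combination of expressions with integral 0, minus \<nu> times the squared
  gradient.\<close>

lemma energy_identity:
  assumes t: "t \<in> {t0<..<T}"
  shows "((\<lambda>x. \<Sum>i\<in>UNIV. W i (x, t) * dt (W i) (x, t)) has_integral
    - \<nu> * (\<Sum>i\<in>UNIV. \<Sum>j\<in>UNIV. integral \<Omega> (\<lambda>x. (pd j (\<lambda>y. u t y $ i) x)\<^sup>2))) \<Omega>"
proof -
  note tI = in_I(1)[OF t]
  note sub = subsetD[OF closure_subset[of \<Omega>]]
  have w0: "w t x = 0" "W i (x, t) = 0" if "x \<in> frontier \<Omega>" for x i
    using w_frontier_0[OF t that] by (simp_all add: W_def)
  have C1w: "C1 U (\<lambda>x. w t x $ i)" for i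
    unfolding comp by (rule slice(1)[OF smooth(1) tI])
  have pressure: "((\<lambda>x. grad (\<lambda>x. f (x, t)) x \<bullet> w t x + f (x, t) * divg (w t) x) has_integral 0) \<Omega>"
    if "smooth_on (U \<times> I) f" for f
    by (rule integral_scaled_tangential[OF rho bounded_\<Omega> U slice(1)[OF that tI] C1w]) (simp add: w0)
  \<comment> \<open>As \<open>w\<close> is divergence free, convection tested with component
    \<open>i\<close> is half the derivative of the square of that component along
    \<open>w\<close>.\<close>
  have conv: "((\<lambda>x. grad (\<lambda>x. W i (x, t) * W i (x, t)) x \<bullet> w t x + W i (x, t) * W i (x, t) * divg (w t) x)
      has_integral 0) \<Omega>" for i
    by (rule integral_scaled_tangential[OF rho bounded_\<Omega> U
          C1_mult[OF U(1) slice(1)[OF smooth(1) tI] slice(1)[OF smooth(1) tI]] C1w]) (simp add: w0)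
  \<comment> \<open>Here the scalar factor \<open>W i\<close> vanishes on the frontier, so the
    gradient need not be tangential; in the two identities above it is the field \<open>w\<close>
    that vanishes.\<close>
  have visc: "((\<lambda>x. grad (\<lambda>x. W i (x, t)) x \<bullet> grad (\<lambda>x. W i (x, t)) x
      + W i (x, t) * divg (grad (\<lambda>x. W i (x, t))) x) has_integral 0) \<Omega>" for i
    by (rule integral_scaled_tangential[OF rho bounded_\<Omega> U slice(1)[OF smooth(1) tI]])
      (auto simp: w0 grad_def intro: slice(2)[OF smooth(1) tI])
  have dissipation: "((\<lambda>x. (pd j (\<lambda>y. u t y $ i) x)\<^sup>2) has_integral integral \<Omega> (\<lambda>x. (pd j (\<lambda>y. u t y $ i) x)\<^sup>2)) \<Omega>" for i j
  proof -
    have "continuous_on (closure \<Omega>) (pd j (\<lambda>y. u t y $ i))"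
      using C1_subset[OF slice(1)[OF smooth(2) tI] U(2)] unfolding comp by (auto simp: C1_def)
    then show ?thesis
      by (intro integrable_integral integrable_on_continuous_closure open_\<Omega> bounded_\<Omega> continuous_intros)
  qed
  \<comment> \<open>Coefficients: -1 for the force potential and the pressure, -1/2 for convection,
    \<nu> for viscosity. The last term removes the squared gradient that the viscous identity adds,
    and it alone has a nonzero integral in general.\<close>
  note int = has_integral_diff[OF has_integral_add[OF has_integral_diff[OF has_integral_neg[OF has_integral_add[OF
      pressure[OF smooth(4)] pressure[OF smooth(3)]]]
      has_integral_mult_right[of _ _ _ "1/2", OF has_integral_sum[OF finite conv]]]
      has_integral_mult_right[of _ _ _ \<nu>, OF has_integral_sum[OF finite visc]]]
      has_integral_mult_right[of _ _ _ \<nu>, OF has_integral_sum[OF finite has_integral_sum[OF finite dissipation]]]]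
  show ?thesis
  proof (rule has_integral_eq[rotated, OF has_integral_eq_rhs[OF int]])
    fix x assume x: "x \<in> \<Omega>"
    note xU = in_U(2)[OF x]
    have VW: "V i (x, t) = W i (x, t)" for i
      using u_eq_w[OF t x] by (simp add: V_def W_def)
    have pdu: "pd j (\<lambda>y. u t y $ i) x = dx j (W i) (x, t)" for i j
    proof -
      have "pd j (\<lambda>y. u t y $ i) x = pd j (\<lambda>y. W i (y, t)) x"
        by (rule pd_cong[OF open_\<Omega> x]) (auto simp: u_eq_w[OF t] comp intro: differentiable_slice smooth xU tI)
      then show ?thesis by (simp add: slice(3)[OF smooth(1) tI xU])
    qed
    then have dV: "dx j (V i) (x, t) = dx j (W i) (x, t)" for i j
      unfolding comp by (simp add: slice(3)[OF smooth(2) tI xU])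
    have div: "divg (w t) x = 0" by (rule divg_w_0[OF t sub[OF x]])
    have lapW: "divg (grad (\<lambda>x. W i (x, t))) x = (\<Sum>j\<in>UNIV. dx j (dx j (W i)) (x, t))" for i
      using slice(5)[OF smooth(1) tI xU] by (simp add: divg_def lap_def grad_def)
    have gradf: "grad (\<lambda>x. f (x, t)) x $ i = dx i f (x, t)" if "smooth_on (U \<times> I) f" for f i
      by (simp add: grad_def slice(3)[OF that tI xU])
    have grad2: "grad (\<lambda>x. W i (x, t) * W i (x, t)) x $ j = 2 * W i (x, t) * dx j (W i) (x, t)" for i j
      using differentiable_slice[OF smooth(1) xU tI] by (simp add: grad_def pd_mult slice(3)[OF smooth(1) tI xU])
    have mom: "dt (W i) (x, t) = - dx i P (x, t) - (\<Sum>j\<in>UNIV. W j (x, t) * dx j (W i) (x, t)) - dx i Q (x, t)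
        + \<nu> * (\<Sum>j\<in>UNIV. dx j (dx j (W i)) (x, t))" for i
      using momentum[OF t sub[OF x], of i] xU tI by (simp add: field_eqs VW dV)
    show "- (grad (\<lambda>x. P (x, t)) x \<bullet> w t x + P (x, t) * divg (w t) x
          + (grad (\<lambda>x. Q (x, t)) x \<bullet> w t x + Q (x, t) * divg (w t) x))
        - 1/2 * (\<Sum>i\<in>UNIV. grad (\<lambda>x. W i (x, t) * W i (x, t)) x \<bullet> w t x + W i (x, t) * W i (x, t) * divg (w t) x)
        + \<nu> * (\<Sum>i\<in>UNIV. grad (\<lambda>x. W i (x, t)) x \<bullet> grad (\<lambda>x. W i (x, t)) x
            + W i (x, t) * divg (grad (\<lambda>x. W i (x, t))) x)
        - \<nu> * (\<Sum>i\<in>UNIV. \<Sum>j\<in>UNIV. (pd j (\<lambda>y. u t y $ i) x)\<^sup>2)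
      = (\<Sum>i\<in>UNIV. W i (x, t) * dt (W i) (x, t))"
      by (simp add: mom div lapW pdu inner_vec_def gradf smooth grad2 comp(1)
          power2_eq_square sum.distrib sum_subtractf sum_negf sum_distrib_left algebra_simps)
  qed (simp_all)
qed

end

theorem theorem7:
  fixes \<Omega> :: "(real^'n) set" and \<rho> :: "real^'n \<Rightarrow> real"
    and \<nu> lam t0 T :: real
    and g w u :: "real \<Rightarrow> real^'n \<Rightarrow> real^'n"
    and q \<phi> :: "real \<Rightarrow> real^'n \<Rightarrow> real"
    and U :: "(real^'n) set" and I :: "real set"
  assumes dom: "smooth_domain \<Omega>" and rho: "defining_fun \<Omega> \<rho>"
    and nu: "\<nu> > 0" and lam: "lam \<ge> 0" and tT: "t0 < T"
    and U: "open U" "closure \<Omega> \<subseteq> U" and I: "open I" "{t0..T} \<subseteq> I"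
    and smooth_w: "smooth_on (U \<times> I) (\<lambda>(x, t). w t x)"
    and smooth_u: "smooth_on (U \<times> I) (\<lambda>(x, t). u t x)"
    and smooth_q: "smooth_on (U \<times> I) (\<lambda>(x, t). q t x)"
    and smooth_phi: "smooth_on (U \<times> I) (\<lambda>(x, t). \<phi> t x)"
    and conservative: "\<forall>t\<in>I. \<forall>x\<in>U. g t x = - grad (\<phi> t) x"
    and sol: "GePUP_E \<Omega> \<rho> \<nu> lam t0 T g w u q"
  shows "\<forall>t\<in>{t0<..<T}.
    ((\<lambda>s. (1/2) * integral \<Omega> (\<lambda>x. u s x \<bullet> u s x)) has_real_derivative
      (- \<nu> * (\<Sum>i\<in>UNIV. \<Sum>j\<in>UNIV. integral \<Omega> (\<lambda>x. (pd j (\<lambda>y. u t y $ i) x)\<^sup>2)))) (at t)"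
proof
  fix t assume t: "t \<in> {t0<..<T}"
  interpret gepup \<Omega> \<rho> \<nu> lam t0 T g w u q \<phi> U I
    by unfold_locales (rule dom rho nu tT U I smooth_w smooth_u smooth_q smooth_phi conservative sol)+
  show "((\<lambda>s. (1/2) * integral \<Omega> (\<lambda>x. u s x \<bullet> u s x)) has_real_derivative
      (- \<nu> * (\<Sum>i\<in>UNIV. \<Sum>j\<in>UNIV. integral \<Omega> (\<lambda>x. (pd j (\<lambda>y. u t y $ i) x)\<^sup>2)))) (at t)"
    using energy_derivative[OF t] unfolding integral_unique[OF energy_identity[OF t]] .
qed

end
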